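(* Let $n\ge 1$ and let $\equiv$ be any lattice congruence of the weak order on $S_n$. Let $R_n\subseteq S_n$ be the set defined recursively below. Then $R_n$ contains exactly one permutation from each equivalence class of $\equiv$, and $R_n$ is a zigzag language. Moreover, Algorithm J run on $L_n:=R_n$ with initial permutation $\pi_0=\mathrm{id}_n$ visits every permutation of $R_n$ exactly once, say in the order $\pi_1,\pi_2,\ldots$, and the sequence of classes $X(\pi_1),X(\pi_2),\ldots$ is a Hamilton path in the cover graph of the lattice quotient $S_n/{\equiv}$: any two consecutive classes form a cover relation in $S_n/{\equiv}$. In particular, the cover graph of $S_n/{\equiv}$ has a Hamilton path.
   Context: $S_n$ is the set of permutations of $[n]=\{1,\dots,n\}$ in one-line notation $\pi=a_1\cdots a_n$. The inversion set of $\pi$ is $\mathrm{inv}(\pi)=\{(a_i,a_j): i<j,\ a_i>a_j\}$. The weak order on $S_n$ is defined by $\pi\le\rho$ iff $\mathrm{inv}(\pi)\subseteq\mathrm{inv}(\rho)$. It is a lattice, and its cover relations are exactly the pairs of permutations that differ by swapping two entries at adjacent positions. A lattice congruence is an equivalence relation $\equiv$ on $S_n$ such that $\pi\equiv\pi'$ and $\rho\equiv\rho'$ imply $\pi\vee\rho\equiv\pi'\vee\rho'$ and $\pi\wedge\rho\equiv\pi'\wedge\rho'$. The lattice quotient $S_n/{\equiv}$ is the set of equivalence classes, ordered by $X<Y$ iff $x<y$ for some $x\in X$, $y\in Y$. Its cover graph is the graph of its cover relations. For $\pi\in S_n$, $X(\pi)$ denotes the class of $\pi$. Notation. $\mathrm{id}_n=12\cdots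 n$, and $\varepsilon$ is the empty permutation. For $\pi\in S_{n-1}$ and $1\le i\le n$, $c_i(\pi)\in S_n$ is obtained by inserting the value $n$ at position $i$ of $\pi$. For $\pi\in S_n$, $p(\pi)\in S_{n-1}$ is obtained by deleting the value $n$. Restriction. The restriction $\equiv^*$ of $\equiv$ is the relation on $S_{n-1}$ given by $\pi\equiv^*\rho$ iff $c_n(\pi)\equiv c_n(\rho)$. It is a lattice congruence of the weak order on $S_{n-1}$. Definition of $R_n$. Set $R_0=\{\varepsilon\}$. For $n\ge1$, let $R_{n-1}$ be the set constructed recursively for $\equiv^*$. - If $\mathrm{id}_n\not\equiv c_{n-1}(\mathrm{id}_{n-1})$: for each $\pi\in R_{n-1}$, let $R_\pi$ contain exactly one element of $X\cap\{c_1(\pi),\dots,c_n(\pi)\}$ for every class $X$ meeting this set, chosen so that $c_1(\pi),c_n(\pi)\in R_\pi$ (these lie in distinct classes). Set $R_n=\bigcup_{\pi\in R_{n-1}}R_\pi$. - Otherwise, set $R_n=\{c_n(\pi):\pi\in R_{n-1}\}$. Zigzag language. $L_n\subseteq S_n$ is a zigzag language if either $n=0$ and $L_0=\{\varepsilon\}$, or $n\ge1$, $L_{n-1}:=\{p(\pi):\pi\in L_n\}$ is a zigzag language, and one of the following holds: - (z1) $c_1(\pi),c_n(\pi)\in L_n$ for all $\pi\in L_{n-1}$; - (z2) $L_n=\{c_n(\pi):\pi\in L_{n-1}\}$. Jumps. Given a substring $a_i\cdots a_j$ of a permutation with $a_i>a_{i+1},\dots,a_j$, a right jump of the value $a_i$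 by $j-i$ steps replaces this substring by $a_{i+1}\cdots a_ja_i$. Given a substring with $a_j>a_i,\dots,a_{j-1}$, a left jump of $a_j$ by $j-i$ steps replaces it by $a_ja_i\cdots a_{j-1}$. A jump is minimal with respect to $L_n$ if it produces a permutation in $L_n$ and every jump of the same value in the same direction by fewer steps produces a permutation not in $L_n$. Algorithm J (input $L_n$ and $\pi_0\in L_n$). Visit $\pi_0$. Then repeat the following step: - In the most recently visited permutation, consider the values $n,n-1,\dots,2$ in this order, and take the first value admitting a minimal jump that produces a not-yet-visited permutation of $L_n$. - If this value admits such jumps in both directions, terminate. Otherwise perform the jump and visit the resulting permutation. - If no value admits such a jump, terminate. *)

theory Defs
  imports Main
begin

type_synonym perm = "nat list"

definition Sn :: "nat \<Rightarrow> perm set" where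
  "Sn n = {xs. distinct xs \<and> set xs = {1..n}}"

definition id_perm :: "nat \<Rightarrow> perm" where
  "id_perm n = [1..<Suc n]"

definition ins :: "perm \<Rightarrow> nat \<Rightarrow> perm" where
  "ins xs i = take (i - 1) xs @ [Suc (length xs)] @ drop (i - 1) xs"

definition pdel :: "nat \<Rightarrow> perm \<Rightarrow> perm" where
  "pdel n xs = removeAll n xs"

definition invset :: "perm \<Rightarrow> (nat \<times> nat) set" where
  "invset xs = {(xs ! i, xs ! j) | i j. i < j \<and> j < length xs \<and> xs ! i > xs ! j}"

definition wle :: "perm \<Rightarrow> perm \<Rightarrow> bool" where
  "wle x y \<longleftrightarrow> invset x \<subseteq> invset y"

definition wlt :: "perm \<Rightarrow> perm \<Rightarrow> bool" where
  "wlt x y \<longleftrightarrow> wle x y \<and> x \<noteq> y"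

definition wjoin :: "nat \<Rightarrow> perm \<Rightarrow> perm \<Rightarrow> perm" where
  "wjoin n x y = (THE z. z \<in> Sn n \<and> wle x z \<and> wle y z \<and>
                   (\<forall>w\<in>Sn n. wle x w \<and> wle y w \<longrightarrow> wle z w))"

definition wmeet :: "nat \<Rightarrow> perm \<Rightarrow> perm \<Rightarrow> perm" where
  "wmeet n x y = (THE z. z \<in> Sn n \<and> wle z x \<and> wle z y \<and>
                   (\<forall>w\<in>Sn n. wle w x \<and> wle w y \<longrightarrow> wle w z))"

definition lattice_congruence :: "nat \<Rightarrow> (perm \<Rightarrow> perm \<Rightarrow> bool) \<Rightarrow> bool" where
  "lattice_congruence n eq \<longleftrightarrow>
     (\<forall>x\<in>Sn n. eq x x) \<and>
     (\<forall>x\<in>Sn n. \<forall>y\<in>Sn n. eq x y \<longrightarrow> eq y x) \<and>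
     (\<forall>x\<in>Sn n. \<forall>y\<in>Sn n. \<forall>z\<in>Sn n. eq x y \<and> eq y z \<longrightarrow> eq x z) \<and>
     (\<forall>x\<in>Sn n. \<forall>x'\<in>Sn n. \<forall>y\<in>Sn n. \<forall>y'\<in>Sn n. eq x x' \<and> eq y y' \<longrightarrow>
         eq (wjoin n x y) (wjoin n x' y') \<and> eq (wmeet n x y) (wmeet n x' y'))"

definition cls :: "nat \<Rightarrow> (perm \<Rightarrow> perm \<Rightarrow> bool) \<Rightarrow> perm \<Rightarrow> perm set" where
  "cls n eq x = {y \<in> Sn n. eq x y}"

definition classes :: "nat \<Rightarrow> (perm \<Rightarrow> perm \<Rightarrow> bool) \<Rightarrow> perm set set" where
  "classes n eq = cls n eq ` Sn n"

definition qless :: "perm set \<Rightarrow> perm set \<Rightarrow> bool" where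
  "qless X Y \<longleftrightarrow> X \<noteq> Y \<and> (\<exists>x\<in>X. \<exists>y\<in>Y. wlt x y)"

definition qcover :: "nat \<Rightarrow> (perm \<Rightarrow> perm \<Rightarrow> bool) \<Rightarrow> perm set \<Rightarrow> perm set \<Rightarrow> bool" where
  "qcover n eq X Y \<longleftrightarrow> X \<in> classes n eq \<and> Y \<in> classes n eq \<and> qless X Y \<and>
     \<not> (\<exists>Z\<in>classes n eq. qless X Z \<and> qless Z Y)"

definition qadj :: "nat \<Rightarrow> (perm \<Rightarrow> perm \<Rightarrow> bool) \<Rightarrow> perm set \<Rightarrow> perm set \<Rightarrow> bool" where
  "qadj n eq X Y \<longleftrightarrow> qcover n eq X Y \<or> qcover n eq Y X"

definition restr :: "nat \<Rightarrow> (perm \<Rightarrow> perm \<Rightarrow> bool) \<Rightarrow> perm \<Rightarrow> perm \<Rightarrow> bool" where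
  "restr m eq x y \<longleftrightarrow> eq (ins x (Suc m)) (ins y (Suc m))"

text \<open>is_R n eq R: R is one of the sets R_n produced by the recursive
  construction (which involves choices) for the congruence eq on S_n.\<close>
fun is_R :: "nat \<Rightarrow> (perm \<Rightarrow> perm \<Rightarrow> bool) \<Rightarrow> perm set \<Rightarrow> bool" where
  "is_R 0 eq R \<longleftrightarrow> R = {[]}"
| "is_R (Suc m) eq R \<longleftrightarrow>
    (\<exists>R'. is_R m (restr m eq) R' \<and>
      (if \<not> eq (id_perm (Suc m)) (ins (id_perm m) m)
       then (\<exists>Rp. (\<forall>x\<in>R'. Rp x \<subseteq> ins x ` {1..Suc m} \<and>
                             ins x 1 \<in> Rp x \<and> ins x (Suc m) \<in> Rp x \<and>
                             (\<forall>z\<in>ins x ` {1..Suc m}. \<exists>!y. y \<in> Rp x \<and> eq z y)) \<and>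
                  R = (\<Union>x\<in>R'. Rp x))
       else R = (\<lambda>x. ins x (Suc m)) ` R'))"

fun zigzag :: "nat \<Rightarrow> perm set \<Rightarrow> bool" where
  "zigzag 0 L \<longleftrightarrow> L = {[]}"
| "zigzag (Suc m) L \<longleftrightarrow> L \<subseteq> Sn (Suc m) \<and> zigzag m (pdel (Suc m) ` L) \<and>
     ((\<forall>x\<in>pdel (Suc m) ` L. ins x 1 \<in> L \<and> ins x (Suc m) \<in> L) \<or>
      L = (\<lambda>x. ins x (Suc m)) ` (pdel (Suc m) ` L))"

datatype jdir = JLeft | JRight

definition pos :: "perm \<Rightarrow> nat \<Rightarrow> nat" where
  "pos xs v = length (takeWhile (\<lambda>x. x \<noteq> v) xs)"

text \<open>Jump of value v by d steps in direction dir (None if not a valid jump).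
  Positions are 0-based here.\<close>
definition jump :: "perm \<Rightarrow> nat \<Rightarrow> jdir \<Rightarrow> nat \<Rightarrow> perm option" where
  "jump xs v dir d =
    (let p = pos xs v in
     if v \<notin> set xs \<or> d = 0 then None else
     (case dir of
        JRight \<Rightarrow> if p + d < length xs \<and> (\<forall>k\<in>{Suc p..p + d}. xs ! k < v)
                  then Some (take p xs @ take d (drop (Suc p) xs) @ [v] @ drop (Suc (p + d)) xs)
                  else None
      | JLeft \<Rightarrow> if d \<le> p \<and> (\<forall>k\<in>{p - d..<p}. xs ! k < v)
                 then Some (take (p - d) xs @ [v] @ take d (drop (p - d) xs) @ drop (Suc p) xs)
                 else None))"

definition jump_ok :: "perm set \<Rightarrow> perm \<Rightarrow> nat \<Rightarrow> jdir \<Rightarrow> nat \<Rightarrow> bool" where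
  "jump_ok L xs v dir d \<longleftrightarrow> (\<exists>y. jump xs v dir d = Some y \<and> y \<in> L)"

definition min_jump :: "perm set \<Rightarrow> perm \<Rightarrow> nat \<Rightarrow> jdir \<Rightarrow> perm option" where
  "min_jump L xs v dir =
    (if \<exists>d. jump_ok L xs v dir d
     then jump xs v dir (LEAST d. jump_ok L xs v dir d) else None)"

definition J_next :: "perm set \<Rightarrow> nat \<Rightarrow> perm list \<Rightarrow> perm option" where
  "J_next L n vs =
    (let cur = last vs;
         cand = (\<lambda>v dir. case min_jump L cur v dir of
                           None \<Rightarrow> None
                         | Some y \<Rightarrow> if y \<in> set vs then None else Some y);
         vals = filter (\<lambda>v. cand v JLeft \<noteq> None \<or> cand v JRight \<noteq> None) (rev [2..<Suc n])
     in case vals of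
          [] \<Rightarrow> None
        | v # _ \<Rightarrow> if cand v JLeft \<noteq> None \<and> cand v JRight \<noteq> None then None
                   else if cand v JLeft \<noteq> None then cand v JLeft else cand v JRight)"

definition J_run :: "perm set \<Rightarrow> nat \<Rightarrow> perm \<Rightarrow> perm list \<Rightarrow> bool" where
  "J_run L n x0 ps \<longleftrightarrow> ps \<noteq> [] \<and> hd ps = x0 \<and>
     (\<forall>i. 0 < i \<and> i < length ps \<longrightarrow> J_next L n (take i ps) = Some (ps ! i)) \<and>
     J_next L n ps = None"

end

theory Submission
  imports Defs
begin

text \<open>The classes of \<open>\<equiv>\<close> that meet a rail \<open>c\<^sub>n(\<pi>) < \<dots> < c\<^sub>1(\<pi>)\<close> do so in intervals. Deleting the
  largest value is a lattice homomorphism of the weak orders, so it maps every class of \<open>\<equiv>\<close> onto a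
  class of the restriction \<open>\<equiv>\<^sup>*\<close>; hence one representative of each class on each rail over \<open>R\<^sub>n\<^sub>-\<^sub>1\<close> is a
  system of representatives. Either every rail lies in a single class or no rail has equivalent ends:
  both are decided by whether \<open>id \<equiv> c\<^sub>n\<^sub>-\<^sub>1(id)\<close>.

  Algorithm J runs along the rails over the permutations visited by Algorithm J for \<open>R\<^sub>n\<^sub>-\<^sub>1\<close>, alternately
  leftwards and rightwards. Between two rails the value \<open>n\<close> is at an end and
  has no unvisited jump, so the jumps of the smaller values are those of the algorithm for \<open>R\<^sub>n\<^sub>-\<^sub>1\<close>.
  Consecutive classes always contain elements whose inversion sets differ by one pair; this property
  survives putting \<open>n\<close> at the front or at the end, and it forces a cover relation in the quotient.\<close>

subsection \<open>Inversion sets\<close>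

lemma invset_Nil [simp]: "invset [] = {}"
  by (simp add: invset_def)

lemma invset_Cons: "invset (x # xs) = {(x, b) | b. b \<in> set xs \<and> b < x} \<union> invset xs"
proof (intro set_eqI iffI)
  fix q assume "q \<in> invset (x # xs)"
  then obtain i j where ij: "q = ((x # xs) ! i, (x # xs) ! j)" "i < j" "j < length (x # xs)"
    "(x # xs) ! i > (x # xs) ! j"
    unfolding invset_def by blast
  then obtain j' where j': "j = Suc j'" by (cases j) auto
  show "q \<in> {(x, b) | b. b \<in> set xs \<and> b < x} \<union> invset xs"
  proof (cases i)
    case 0
    then show ?thesis using ij j' by auto
  next
    case (Suc i')
    then have "q \<in> invset xs" using ij j' unfolding invset_def by auto
    then show ?thesis by simp
  qed
next
  fix q assume "q \<in> {(x, b) | b. b \<in> set xs \<and> b < x} \<union> invset xs"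
  then consider b where "q = (x, b)" "b \<in> set xs" "b < x" | "q \<in> invset xs" by auto
  then show "q \<in> invset (x # xs)"
  proof cases
    case 1
    then obtain j where "j < length xs" "xs ! j = b" by (auto simp: in_set_conv_nth)
    then show ?thesis using 1 unfolding invset_def
      by (intro CollectI exI[of _ 0] exI[of _ "Suc j"]) auto
  next
    case 2
    then obtain i j where "q = (xs ! i, xs ! j)" "i < j" "j < length xs" "xs ! i > xs ! j"
      unfolding invset_def by blast
    then show ?thesis unfolding invset_def
      by (intro CollectI exI[of _ "Suc i"] exI[of _ "Suc j"]) auto
  qed
qed

lemma invset_append:
  "invset (xs @ ys) = invset xs \<union> invset ys \<union> {(a, b). a \<in> set xs \<and> b \<in> set ys \<and> b < a}"
  by (induction xs) (auto simp: invset_Cons)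

lemma invset_subset: "invset xs \<subseteq> {(a, b). a \<in> set xs \<and> b \<in> set xs \<and> b < a}"
  by (induction xs) (auto simp: invset_Cons)

text \<open>The smaller entry of an inversion stands further right, so it cannot leave a suffix that
  holds the larger one. The main use is for the suffix to the right of the inserted maximum.\<close>

lemma invset_append_right:
  assumes "distinct (xs @ ys)" "(a, b) \<in> invset (xs @ ys)" "a \<in> set ys"
  shows "b \<in> set ys"
  using assms invset_subset[of xs] invset_subset[of ys] by (auto simp: invset_append)

lemma invset_rev:
  assumes "distinct xs"
  shows "invset (rev xs) = {(a, b). a \<in> set xs \<and> b \<in> set xs \<and> b < a} - invset xs"
  using assms
proof (induction xs)
  case (Cons x xs)
  have "(x, b) \<notin> invset xs" "(b, x) \<notin> invset xs" for b
    using Cons.prems invset_subset[of xs] by auto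
  then show ?case using Cons by (auto simp: invset_Cons invset_append)
qed simp

section \<open>Inserting and deleting the largest value\<close>

lemma Sn_length: "x \<in> Sn n \<Longrightarrow> length x = n"
  unfolding Sn_def using distinct_card by fastforce

lemma ins_Suc_length: "ins x (Suc (length x)) = x @ [Suc (length x)]"
  by (simp add: ins_def)

lemma ins_1: "ins x (Suc 0) = Suc (length x) # x"
  by (simp add: ins_def)

lemma ins_append: "ins (u @ v) (Suc (length u)) = u @ Suc (length u + length v) # v"
  by (simp add: ins_def)

text \<open>The index is arbitrary: truncated subtraction makes \<open>i = 0\<close> behave like
  \<open>i = 1\<close>, and every \<open>i\<close> above \<open>m\<close> appends
  \<open>Suc m\<close>.\<close>

lemma ins_decomp:
  assumes "x \<in> Sn m"
  obtains u v where "x = u @ v" "v = drop (i - 1) x" "ins x i = u @ Suc m # v"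
    "distinct u" "distinct v" "set u \<inter> set v = {}" "set u \<union> set v = {1..m}"
    "Suc m \<notin> set u" "Suc m \<notin> set v"
proof (rule that)
  show "x = take (i - 1) x @ drop (i - 1) x" by simp
  have x: "distinct (take (i - 1) x @ drop (i - 1) x)" "set (take (i - 1) x @ drop (i - 1) x) = {1..m}"
    using assms by (simp_all only: append_take_drop_id) (simp_all add: Sn_def)
  show "distinct (take (i - 1) x)" "distinct (drop (i - 1) x)"
    "set (take (i - 1) x) \<inter> set (drop (i - 1) x) = {}"
    using x(1) by (simp_all only: distinct_append)
  show un: "set (take (i - 1) x) \<union> set (drop (i - 1) x) = {1..m}"
    using x(2) by (simp only: set_append)
  have "Suc m \<notin> {1..m}" by simp
  then show "Suc m \<notin> set (take (i - 1) x)" "Suc m \<notin> set (drop (i - 1) x)"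
    unfolding un[symmetric] by blast+
qed (simp_all add: ins_def Sn_length[OF assms])

lemma ins_Sn:
  assumes "x \<in> Sn m"
  shows "ins x i \<in> Sn (Suc m)"
proof -
  obtain u v where uv: "ins x i = u @ Suc m # v"
    "distinct u" "distinct v" "set u \<inter> set v = {}" "set u \<union> set v = {1..m}"
    "Suc m \<notin> set u" "Suc m \<notin> set v"
    using assms by (rule ins_decomp[where i = i])
  have "set (ins x i) = insert (Suc m) (set u \<union> set v)" using uv(1) by simp
  also have "\<dots> = {1..Suc m}" using uv(5) by (simp add: atLeastAtMostSuc_conv)
  finally show ?thesis using uv by (simp add: Sn_def)
qed

text \<open>Since \<open>Suc m\<close> exceeds every entry of \<open>x\<close>, it forms inversions
  exactly with the values to its right. Comparisons along rails are therefore read off from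
  \<open>set (drop (i - 1) x)\<close>.\<close>

lemma invset_ins:
  assumes "x \<in> Sn m"
  shows "invset (ins x i) = invset x \<union> Pair (Suc m) ` set (drop (i - 1) x)"
proof -
  obtain u v where uv: "x = u @ v" "v = drop (i - 1) x" "ins x i = u @ Suc m # v"
    "set u \<union> set v = {1..m}"
    using assms by (rule ins_decomp[where i = i])
  have le: "a \<le> m" if "a \<in> set u \<union> set v" for a using that uv(4) by simp
  have "invset (u @ Suc m # v) = invset (u @ v) \<union> Pair (Suc m) ` set v"
    using le by (fastforce simp: invset_append invset_Cons)
  then show ?thesis using uv by metis
qed

lemma invset_Sn: "x \<in> Sn n \<Longrightarrow> (a, b) \<in> invset x \<Longrightarrow> b < a \<and> 1 \<le> b \<and> a \<le> n"
  using invset_subset[of x] by (auto simp: Sn_def)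

lemma pdel_ins: "x \<in> Sn m \<Longrightarrow> pdel (Suc m) (ins x i) = x"
proof -
  assume "x \<in> Sn m"
  then obtain u v where uv: "x = u @ v" "ins x i = u @ Suc m # v" "Suc m \<notin> set u" "Suc m \<notin> set v"
    by (rule ins_decomp[where i = i])
  then show ?thesis using uv by (simp add: pdel_def)
qed

lemma Sn_cases:
  assumes "x \<in> Sn (Suc m)"
  obtains p i where "p \<in> Sn m" "i \<in> {1..Suc m}" "x = ins p i"
proof -
  have "Suc m \<in> set x" using assms by (auto simp: Sn_def)
  then obtain u v where x: "x = u @ Suc m # v" by (auto simp: in_set_conv_decomp)
  have d: "distinct x" "set x = {1..Suc m}" using assms by (auto simp: Sn_def)
  have len: "length u + length v = m" using Sn_length[OF assms] x by simp
  have "Suc m \<notin> set (u @ v)" using d x by auto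
  moreover have "set x = insert (Suc m) (set (u @ v))" using x by auto
  ultimately have "set (u @ v) = {1..Suc m} - {Suc m}" using d by auto
  moreover have "{1..Suc m} - {Suc m} = {1..m}" by auto
  ultimately have "set (u @ v) = {1..m}" by (rule trans)
  then have "u @ v \<in> Sn m" using d x by (auto simp: Sn_def)
  moreover have "x = ins (u @ v) (Suc (length u))" using x len by (simp add: ins_append)
  moreover have "Suc (length u) \<in> {1..Suc m}" using len by simp
  ultimately show thesis by (metis that)
qed

lemma pdel_Sn: "x \<in> Sn (Suc m) \<Longrightarrow> pdel (Suc m) x \<in> Sn m"
  by (metis Sn_cases pdel_ins)

lemma ins_pdel: "x \<in> Sn (Suc m) \<Longrightarrow> \<exists>i\<in>{1..Suc m}. x = ins (pdel (Suc m) x) i"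
  by (metis Sn_cases pdel_ins)

lemma invset_pdel:
  assumes "x \<in> Sn (Suc m)"
  shows "invset (pdel (Suc m) x) = {(a, b) \<in> invset x. a \<le> m}"
proof -
  obtain p i where p: "p \<in> Sn m" "x = ins p i" using assms by (rule Sn_cases)
  then show ?thesis using invset_Sn[OF p(1)] by (auto simp: pdel_ins invset_ins)
qed

lemma ins_inj:
  assumes "x \<in> Sn m" "i \<in> {1..Suc m}" "j \<in> {1..Suc m}" "ins x i = ins x j"
  shows "i = j"
proof -
  have "invset (ins x i) = invset (ins x j)" using assms by simp
  moreover have "Suc m \<noteq> a" if "(a, b) \<in> invset x" for a b using invset_Sn[OF assms(1) that] by auto
  ultimately have "set (drop (i - 1) x) = set (drop (j - 1) x)"
    unfolding invset_ins[OF assms(1)] by blast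
  moreover have "distinct x" using assms(1) by (simp add: Sn_def)
  ultimately have "length (drop (i - 1) x) = length (drop (j - 1) x)"
    by (metis distinct_card distinct_drop)
  then show ?thesis using assms Sn_length[OF assms(1)] by auto
qed

text \<open>Induction by deleting the largest value: the inversions with first entry at most
  \<open>m\<close> recover the shorter permutation, and the others give the set of values to the
  right of \<open>Suc m\<close>, whose size fixes its position.\<close>

lemma invset_inject:
  assumes "x \<in> Sn n" "y \<in> Sn n" "invset x = invset y"
  shows "x = y"
  using assms
proof (induction n arbitrary: x y)
  case 0
  then show ?case by (simp add: Sn_def)
next
  case (Suc m)
  let ?p = "pdel (Suc m) x"
  have pe: "?p = pdel (Suc m) y"
    using Suc.IH[of ?p "pdel (Suc m) y"] Suc.prems by (simp add: pdel_Sn invset_pdel)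
  have p: "?p \<in> Sn m" using Suc.prems(1) by (rule pdel_Sn)
  obtain i j where i: "i \<in> {1..Suc m}" "x = ins ?p i" and j: "j \<in> {1..Suc m}" "y = ins ?p j"
    using ins_pdel Suc.prems(1,2) pe by metis
  have "(Suc m, b) \<notin> invset ?p" for b using invset_Sn[OF p, of "Suc m" b] by auto
  moreover have "invset ?p \<union> Pair (Suc m) ` set (drop (i - 1) ?p) = 
      invset ?p \<union> Pair (Suc m) ` set (drop (j - 1) ?p)"
    using Suc.prems(3) invset_ins[OF p] i j by metis
  ultimately have "set (drop (i - 1) ?p) = set (drop (j - 1) ?p)" by blast
  moreover have "distinct ?p" using p by (simp add: Sn_def)
  ultimately have "length (drop (i - 1) ?p) = length (drop (j - 1) ?p)"
    by (metis distinct_card distinct_drop)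
  then have "i = j" using i j Sn_length[OF p] by auto
  then show ?case using i j by simp
qed

lemma wle_refl [simp]: "wle x x"
  by (simp add: wle_def)

lemma wle_antisym: "x \<in> Sn n \<Longrightarrow> y \<in> Sn n \<Longrightarrow> wle x y \<Longrightarrow> wle y x \<Longrightarrow> x = y"
  by (simp add: wle_def invset_inject subset_antisym)

subsection \<open>The weak order is a lattice\<close>

text \<open>A relational form of \<open>wjoin\<close>, so that a join can be exhibited and verified
  directly; \<open>wjoin_eq\<close> returns to the operator.\<close>

definition is_join :: "nat \<Rightarrow> perm \<Rightarrow> perm \<Rightarrow> perm \<Rightarrow> bool" where
  "is_join n x y z \<longleftrightarrow> z \<in> Sn n \<and> wle x z \<and> wle y z \<and>
     (\<forall>w\<in>Sn n. wle x w \<and> wle y w \<longrightarrow> wle z w)"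

definition is_meet :: "nat \<Rightarrow> perm \<Rightarrow> perm \<Rightarrow> perm \<Rightarrow> bool" where
  "is_meet n x y z \<longleftrightarrow> z \<in> Sn n \<and> wle z x \<and> wle z y \<and>
     (\<forall>w\<in>Sn n. wle w x \<and> wle w y \<longrightarrow> wle w z)"

lemma wjoin_eq: "is_join n x y z \<Longrightarrow> wjoin n x y = z"
  unfolding wjoin_def is_join_def by (rule the_equality) (auto intro: wle_antisym)

lemma wmeet_eq: "is_meet n x y z \<Longrightarrow> wmeet n x y = z"
  unfolding wmeet_def is_meet_def by (rule the_equality) (auto intro: wle_antisym)

lemma wle_pdel:
  "x \<in> Sn (Suc m) \<Longrightarrow> y \<in> Sn (Suc m) \<Longrightarrow> wle x y \<Longrightarrow> wle (pdel (Suc m) x) (pdel (Suc m) y)"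
  by (auto simp: wle_def invset_pdel)

text \<open>Pairs that start with \<open>Suc m\<close> do not occur in \<open>p\<close> or
  \<open>q\<close>, so the inclusion of inversion sets splits into two independent ones.\<close>

lemma wle_ins_iff:
  assumes "p \<in> Sn m" "q \<in> Sn m"
  shows "wle (ins p i) (ins q j) \<longleftrightarrow>
    wle p q \<and> set (drop (i - 1) p) \<subseteq> set (drop (j - 1) q)"
proof -
  have "(Suc m, b) \<notin> invset p" "(Suc m, b) \<notin> invset q" for b
    using invset_Sn[OF assms(1), of "Suc m" b] invset_Sn[OF assms(2), of "Suc m" b] by auto
  then show ?thesis unfolding wle_def invset_ins[OF assms(1)] invset_ins[OF assms(2)] by blast
qed

lemma join_exists:
  assumes "x \<in> Sn n" "y \<in> Sn n"
  shows "\<exists>z. is_join n x y z"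
  using assms
proof (induction n arbitrary: x y)
  case 0
  then show ?case by (intro exI[of _ "[]"]) (simp add: is_join_def Sn_def)
next
  case (Suc m)
  obtain p i where p: "p \<in> Sn m" "x = ins p i" using Suc.prems(1) by (rule Sn_cases)
  obtain q j where q: "q \<in> Sn m" "y = ins q j" using Suc.prems(2) by (rule Sn_cases)
  obtain r where r: "is_join m p q r" using Suc.IH p(1) q(1) by blast
  then have rS: "r \<in> Sn m" and pr: "wle p r" and qr: "wle q r"
    and rl: "\<And>w. w \<in> Sn m \<Longrightarrow> wle p w \<Longrightarrow> wle q w \<Longrightarrow> wle r w"
    by (auto simp: is_join_def)
  \<comment> \<open>\<open>T\<close> holds the values that \<open>Suc m\<close> must precede; it is inserted into the join \<open>r\<close> just before
    the first of them.\<close>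
  define T where "T = set (drop (i - 1) p) \<union> set (drop (j - 1) q)"
  define u where "u = takeWhile (\<lambda>a. a \<notin> T) r"
  define v where "v = dropWhile (\<lambda>a. a \<notin> T) r"
  have ruv: "r = u @ v" by (simp add: u_def v_def)
  have dr: "distinct (u @ v)" using rS ruv by (simp add: Sn_def)
  have uT: "set u \<inter> T = {}" unfolding u_def using set_takeWhileD by fastforce
  have "T \<subseteq> set r" using p(1) q(1) rS set_drop_subset unfolding T_def Sn_def by fastforce
  then have Tv: "T \<subseteq> set v" using uT ruv by auto
  define k where "k = Suc (length u)"
  have dk: "drop (k - Suc 0) r = v" by (simp add: k_def ruv)
  have "is_join (Suc m) x y (ins r k)"
    unfolding is_join_def
  proof (intro conjI ballI impI)
    show "ins r k \<in> Sn (Suc m)" using rS by (rule ins_Sn)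
    show "wle x (ins r k)" "wle y (ins r k)"
      using Tv pr qr p q rS by (auto simp: wle_ins_iff dk T_def)
  next
    fix w assume w: "w \<in> Sn (Suc m)" and xyw: "wle x w \<and> wle y w"
    obtain s l where s: "s \<in> Sn m" "w = ins s l" using w by (rule Sn_cases)
    define D where "D = set (drop (l - 1) s)"
    have TD: "T \<subseteq> D" and rs: "wle r s"
      using xyw s p q rl by (auto simp: wle_ins_iff T_def D_def)
    \<comment> \<open>The first entry \<open>t\<close> of \<open>v\<close> lies in \<open>T\<close>,
      hence in \<open>D\<close>. A later \<open>b < t\<close> is inverted with \<open>t\<close> in
      \<open>r\<close>, so in \<open>s\<close>, and follows \<open>t\<close> into \<open>D\<close>.
      A later \<open>b > t\<close> outside \<open>T\<close> cannot exist: it stands left of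
      \<open>Suc m\<close> where \<open>t\<close> stands right, so \<open>(b, t)\<close> would be an
      inversion of \<open>p\<close> or \<open>q\<close> and thus of \<open>r\<close>.\<close>
    have "set v \<subseteq> D"
    proof (cases v)
      case (Cons t v')
      then have tT: "t \<in> T" unfolding v_def by (metis dropWhile_eq_Cons_conv)
      have "b \<in> D" if b: "b \<in> set v'" for b
      proof (cases "b \<in> T")
        case False
        have bt: "b \<noteq> t" using b dr Cons by auto
        show ?thesis
        proof (cases "b < t")
          case True
          then have "(t, b) \<in> invset r" using b by (auto simp: ruv Cons invset_append invset_Cons)
          then have "(t, b) \<in> invset (take (l - 1) s @ drop (l - 1) s)" using rs by (auto simp: wle_def)
          moreover have "distinct (take (l - 1) s @ drop (l - 1) s)" using s by (simp add: Sn_def)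
          moreover have "t \<in> set (drop (l - 1) s)" using tT TD D_def by auto
          ultimately show ?thesis unfolding D_def by (metis invset_append_right)
        next
          case nlt: False
          have br: "b \<in> {1..m}" using b rS ruv Cons by (auto simp: Sn_def)
          have *: "(b, t) \<in> invset p'"
            if "t \<in> set (drop i' p')" "b \<notin> set (drop i' p')" "p' \<in> Sn m" for i' p'
          proof -
            have "b \<in> set (take i' p' @ drop i' p')" using br that(3) by (simp add: Sn_def)
            then have "b \<in> set (take i' p')" using that(2) by (simp del: append_take_drop_id)
            then have "(b, t) \<in> invset (take i' p' @ drop i' p')"
              using that(1) nlt bt by (auto simp: invset_append simp del: append_take_drop_id)
            then show ?thesis by simp
          qed
          have "(b, t) \<in> invset p \<or> (b, t) \<in> invset q"
            using tT False * p(1) q(1) unfolding T_def by blast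
          then have "(b, t) \<in> invset r" using pr qr by (auto simp: wle_def)
          then have "t \<in> set v'" using invset_append_right[of "u @ [t]" v' b t] dr Cons ruv b by simp
          then show ?thesis using dr Cons by simp
        qed
      qed (use TD in auto)
      then show ?thesis using Cons tT TD by auto
    qed simp
    then show "wle (ins r k) w" using rs s rS by (auto simp: wle_ins_iff dk D_def)
  qed
  then show ?case ..
qed

lemma rev_Sn [simp]: "rev x \<in> Sn n \<longleftrightarrow> x \<in> Sn n"
  by (simp add: Sn_def)

text \<open>Reversal complements the inversion set within all pairs \<open>(a, b)\<close> with
  \<open>b < a\<close>. As an order-reversing map it turns joins into meets, which saves a second
  construction.\<close>

lemma wle_rev:
  assumes "x \<in> Sn n" "y \<in> Sn n"
  shows "wle (rev x) (rev y) \<longleftrightarrow> wle y x"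
proof -
  define U where "U = {(a, b). a \<in> {1..n} \<and> b \<in> {1..n} \<and> b < a}"
  have r: "invset (rev x) = U - invset x" "invset (rev y) = U - invset y"
    using assms by (simp_all add: invset_rev Sn_def U_def)
  have "set y = {1..n}" using assms by (simp add: Sn_def)
  then have "invset y \<subseteq> U" using invset_subset[of y] unfolding U_def by metis
  then show ?thesis unfolding wle_def r by blast
qed

lemma is_meet_rev:
  assumes "x \<in> Sn n" "y \<in> Sn n" "is_join n (rev x) (rev y) z"
  shows "is_meet n x y (rev z)"
proof -
  have z: "z \<in> Sn n" "wle (rev x) z" "wle (rev y) z"
    and least: "\<And>w. w \<in> Sn n \<Longrightarrow> wle (rev x) w \<Longrightarrow> wle (rev y) w \<Longrightarrow> wle z w"
    using assms(3) by (auto simp: is_join_def)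
  have anti: "wle (rev z) w \<longleftrightarrow> wle (rev w) z" "wle w (rev z) \<longleftrightarrow> wle z (rev w)"
    if "w \<in> Sn n" for w
    using wle_rev[of z n "rev w"] wle_rev[of "rev w" n z] that z(1) by simp_all
  have "wle w (rev z)" if "w \<in> Sn n" "wle w x" "wle w y" for w
    using least[of "rev w"] that assms(1,2) by (simp add: anti wle_rev[of _ n])
  then show ?thesis using assms(1,2) z by (simp add: is_meet_def anti)
qed

lemma meet_exists: "x \<in> Sn n \<Longrightarrow> y \<in> Sn n \<Longrightarrow> \<exists>z. is_meet n x y z"
  using is_meet_rev join_exists[of "rev x" n "rev y"] rev_Sn by metis

lemma is_join_commute: "is_join n x y z \<longleftrightarrow> is_join n y x z"
  by (auto simp: is_join_def)

lemma is_meet_commute: "is_meet n x y z \<longleftrightarrow> is_meet n y x z"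
  by (auto simp: is_meet_def)

lemma is_join_unique: "is_join n x y z \<Longrightarrow> is_join n x y z' \<Longrightarrow> z = z'"
  using wjoin_eq by metis

lemma is_meet_unique: "is_meet n x y z \<Longrightarrow> is_meet n x y z' \<Longrightarrow> z = z'"
  using wmeet_eq by metis

lemma is_join_absorb: "y \<in> Sn n \<Longrightarrow> wle x y \<Longrightarrow> is_join n x y y"
  by (simp add: is_join_def)

lemma is_meet_absorb: "x \<in> Sn n \<Longrightarrow> wle x y \<Longrightarrow> is_meet n x y x"
  by (simp add: is_meet_def)

section \<open>The least element and the two ends of a rail\<close>

lemma id_perm_Sn: "id_perm n \<in> Sn n"
  by (auto simp: id_perm_def Sn_def)

lemma invset_id_perm [simp]: "invset (id_perm n) = {}"
proof -
  have "invset [a..<b] = {}" for a b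
    by (induction b) (auto simp: invset_append invset_Cons)
  then show ?thesis unfolding id_perm_def by blast
qed

lemma wle_id_perm [simp]: "wle (id_perm n) x"
  by (simp add: wle_def)

lemma id_perm_Suc: "id_perm (Suc m) = ins (id_perm m) (Suc m)"
  by (simp add: id_perm_def ins_def)

lemma wle_ins_last:
  assumes "p \<in> Sn m" "q \<in> Sn m"
  shows "wle (ins p (Suc m)) (ins q j) \<longleftrightarrow> wle p q"
  using assms by (simp add: wle_ins_iff Sn_length)

lemma set_drop_Sn: "p \<in> Sn m \<Longrightarrow> q \<in> Sn m \<Longrightarrow> set (drop i p) \<subseteq> set q"
  using set_drop_subset[of i p] by (simp add: Sn_def)

lemma wle_ins_first:
  assumes "p \<in> Sn m" "q \<in> Sn m"
  shows "wle (ins p i) (ins q (Suc 0)) \<longleftrightarrow> wle p q"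
  using assms by (simp add: wle_ins_iff set_drop_Sn)

lemma wle_ins_rail:
  assumes "p \<in> Sn m" "i \<le> j"
  shows "wle (ins p j) (ins p i)"
  using assms by (simp add: wle_ins_iff set_drop_subset_set_drop)

text \<open>By \<open>wle_ins_last\<close>, whether such an element lies below \<open>w\<close>
  depends only on \<open>w\<close> without \<open>Suc m\<close>. So putting \<open>Suc m\<close>
  last preserves joins.\<close>

lemma is_join_ins_last:
  assumes "x \<in> Sn m" "y \<in> Sn m" "is_join m x y z"
  shows "is_join (Suc m) (ins x (Suc m)) (ins y (Suc m)) (ins z (Suc m))"
  unfolding is_join_def
proof (intro conjI ballI impI)
  have z: "z \<in> Sn m" using assms by (simp add: is_join_def)
  show "ins z (Suc m) \<in> Sn (Suc m)" using z by (rule ins_Sn)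
  show "wle (ins x (Suc m)) (ins z (Suc m))" "wle (ins y (Suc m)) (ins z (Suc m))"
    using assms z by (simp_all add: wle_ins_last is_join_def)
  fix w assume "w \<in> Sn (Suc m)" and w: "wle (ins x (Suc m)) w \<and> wle (ins y (Suc m)) w"
  then obtain s l where s: "s \<in> Sn m" "w = ins s l" by (metis Sn_cases)
  then show "wle (ins z (Suc m)) w"
    using w assms z by (simp add: wle_ins_last is_join_def)
qed

text \<open>Nothing stands right of \<open>Suc m\<close> in the meet once this holds for one factor,
  whatever \<open>i\<close> is. With \<open>i = Suc m\<close> this says that putting
  \<open>Suc m\<close> last preserves meets; with general \<open>i\<close> it moves an element to
  the last end of a rail.\<close>

lemma is_meet_ins_last:
  assumes "x \<in> Sn m" "y \<in> Sn m" "is_meet m x y z"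
  shows "is_meet (Suc m) (ins x (Suc m)) (ins y i) (ins z (Suc m))"
  unfolding is_meet_def
proof (intro conjI ballI impI)
  have z: "z \<in> Sn m" using assms by (simp add: is_meet_def)
  show "ins z (Suc m) \<in> Sn (Suc m)" using z by (rule ins_Sn)
  show "wle (ins z (Suc m)) (ins x (Suc m))" "wle (ins z (Suc m)) (ins y i)"
    using assms z by (simp_all add: wle_ins_last is_meet_def)
  fix w assume "w \<in> Sn (Suc m)" and w: "wle w (ins x (Suc m)) \<and> wle w (ins y i)"
  then obtain s l where s: "s \<in> Sn m" "w = ins s l" by (metis Sn_cases)
  then show "wle w (ins z (Suc m))"
    using w assms z by (simp add: wle_ins_iff is_meet_def Sn_length)
qed

text \<open>An upper bound of \<open>ins b (Suc 0)\<close> has every value to the right of its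
  \<open>Suc m\<close>. Joining with it thus moves \<open>Suc m\<close> to the front and keeps
  \<open>p\<close>.\<close>

lemma is_join_ins_first:
  assumes "p \<in> Sn m" "b \<in> Sn m" "wle b p"
  shows "is_join (Suc m) (ins p i) (ins b (Suc 0)) (ins p (Suc 0))"
  unfolding is_join_def
proof (intro conjI ballI impI)
  show "ins p (Suc 0) \<in> Sn (Suc m)" using assms by (simp add: ins_Sn)
  show "wle (ins p i) (ins p (Suc 0))" "wle (ins b (Suc 0)) (ins p (Suc 0))"
    using assms by (simp_all add: wle_ins_first)
  fix w assume "w \<in> Sn (Suc m)" and w: "wle (ins p i) w \<and> wle (ins b (Suc 0)) w"
  then obtain s l where s: "s \<in> Sn m" "w = ins s l" by (metis Sn_cases)
  moreover have "set p = set b" using assms by (simp add: Sn_def)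
  ultimately show "wle (ins p (Suc 0)) w"
    using w assms by (simp add: wle_ins_iff)
qed

text \<open>Deletion is left adjoint to \<open>ins _ (Suc 0)\<close>: \<open>pdel (Suc m) v\<close>
  is below \<open>w\<close> iff \<open>v\<close> is below \<open>ins w (Suc 0)\<close>. Left
  adjoints preserve joins.\<close>

lemma is_join_pdel:
  assumes "x \<in> Sn (Suc m)" "y \<in> Sn (Suc m)" "is_join (Suc m) x y z"
  shows "is_join m (pdel (Suc m) x) (pdel (Suc m) y) (pdel (Suc m) z)"
  unfolding is_join_def
proof (intro conjI ballI impI)
  have z: "z \<in> Sn (Suc m)" "wle x z" "wle y z" using assms(3) by (simp_all add: is_join_def)
  show "pdel (Suc m) z \<in> Sn m" using z(1) by (rule pdel_Sn)
  show "wle (pdel (Suc m) x) (pdel (Suc m) z)" "wle (pdel (Suc m) y) (pdel (Suc m) z)"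
    using assms z by (auto intro: wle_pdel)
  fix w assume w: "w \<in> Sn m" "wle (pdel (Suc m) x) w \<and> wle (pdel (Suc m) y) w"
  have "wle v (ins w (Suc 0))" if "v \<in> Sn (Suc m)" "wle (pdel (Suc m) v) w" for v
    using ins_pdel[OF that(1)] wle_ins_first[OF pdel_Sn[OF that(1)] w(1)] that(2) by metis
  then have "wle z (ins w (Suc 0))"
    using assms w ins_Sn[OF w(1)] by (simp add: is_join_def)
  then show "wle (pdel (Suc m) z) w"
    using wle_pdel[OF z(1) ins_Sn[OF w(1)]] pdel_ins[OF w(1)] by metis
qed

text \<open>Dually, deletion is right adjoint to \<open>ins _ (Suc m)\<close> and so preserves
  meets.\<close>

lemma is_meet_pdel:
  assumes "x \<in> Sn (Suc m)" "y \<in> Sn (Suc m)" "is_meet (Suc m) x y z"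
  shows "is_meet m (pdel (Suc m) x) (pdel (Suc m) y) (pdel (Suc m) z)"
  unfolding is_meet_def
proof (intro conjI ballI impI)
  have z: "z \<in> Sn (Suc m)" "wle z x" "wle z y" using assms(3) by (simp_all add: is_meet_def)
  show "pdel (Suc m) z \<in> Sn m" using z(1) by (rule pdel_Sn)
  show "wle (pdel (Suc m) z) (pdel (Suc m) x)" "wle (pdel (Suc m) z) (pdel (Suc m) y)"
    using assms z by (auto intro: wle_pdel)
  fix w assume w: "w \<in> Sn m" "wle w (pdel (Suc m) x) \<and> wle w (pdel (Suc m) y)"
  have "wle (ins w (Suc m)) v" if "v \<in> Sn (Suc m)" "wle w (pdel (Suc m) v)" for v
    using ins_pdel[OF that(1)] wle_ins_last[OF w(1) pdel_Sn[OF that(1)]] that(2) by metis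
  then have "wle (ins w (Suc m)) z"
    using assms w ins_Sn[OF w(1)] by (simp add: is_meet_def)
  then show "wle w (pdel (Suc m) z)"
    using wle_pdel[OF ins_Sn[OF w(1)] z(1)] pdel_ins[OF w(1)] by metis
qed

subsection \<open>Congruences and their restrictions\<close>

lemma cong_refl: "lattice_congruence n eq \<Longrightarrow> x \<in> Sn n \<Longrightarrow> eq x x"
  by (simp add: lattice_congruence_def)

lemma cong_sym: "lattice_congruence n eq \<Longrightarrow> x \<in> Sn n \<Longrightarrow> y \<in> Sn n \<Longrightarrow> eq x y \<Longrightarrow> eq y x"
  unfolding lattice_congruence_def by blast

lemma cong_trans:
  "lattice_congruence n eq \<Longrightarrow> x \<in> Sn n \<Longrightarrow> y \<in> Sn n \<Longrightarrow> z \<in> Sn n \<Longrightarrow> eq x y \<Longrightarrow> eq y z \<Longrightarrow> eq x z"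
  unfolding lattice_congruence_def by blast

lemma cong_join:
  assumes "lattice_congruence n eq" "x \<in> Sn n" "x' \<in> Sn n" "y \<in> Sn n" "y' \<in> Sn n"
    "eq x x'" "eq y y'" "is_join n x y z" "is_join n x' y' z'"
  shows "eq z z'"
proof -
  have "eq (wjoin n x y) (wjoin n x' y')"
    using assms unfolding lattice_congruence_def by blast
  then show ?thesis using assms by (simp add: wjoin_eq)
qed

lemma cong_meet:
  assumes "lattice_congruence n eq" "x \<in> Sn n" "x' \<in> Sn n" "y \<in> Sn n" "y' \<in> Sn n"
    "eq x x'" "eq y y'" "is_meet n x y z" "is_meet n x' y' z'"
  shows "eq z z'"
proof -
  have "eq (wmeet n x y) (wmeet n x' y')"
    using assms unfolding lattice_congruence_def by blast
  then show ?thesis using assms by (simp add: wmeet_eq)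
qed

text \<open>Meeting both sides of \<open>eq x z\<close> with \<open>y\<close> gives \<open>x\<close>
  and \<open>y\<close>.\<close>

lemma cong_convex:
  assumes "lattice_congruence n eq" "x \<in> Sn n" "y \<in> Sn n" "z \<in> Sn n"
    "wle x y" "wle y z" "eq x z"
  shows "eq x y"
  using cong_meet[of n eq x z y y x y] assms cong_refl is_meet_absorb is_meet_commute by metis

text \<open>Putting \<open>Suc m\<close> last preserves joins and meets, so a congruence pulls back
  along it.\<close>

lemma restr_congruence:
  assumes c: "lattice_congruence (Suc m) eq"
  shows "lattice_congruence m (restr m eq)"
  unfolding lattice_congruence_def
proof (intro conjI ballI impI)
  fix x assume "x \<in> Sn m"
  then show "restr m eq x x" using cong_refl[OF c] by (simp add: restr_def ins_Sn)
next
  fix x y assume "x \<in> Sn m" "y \<in> Sn m" "restr m eq x y"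
  then show "restr m eq y x" using cong_sym[OF c] by (simp add: restr_def ins_Sn)
next
  fix x y z assume "x \<in> Sn m" "y \<in> Sn m" "z \<in> Sn m" "restr m eq x y \<and> restr m eq y z"
  then show "restr m eq x z"
    using cong_trans[OF c] ins_Sn unfolding restr_def by blast
next
  fix x x' y y' assume xy: "x \<in> Sn m" "x' \<in> Sn m" "y \<in> Sn m" "y' \<in> Sn m"
    and e: "restr m eq x x' \<and> restr m eq y y'"
  obtain z z' where z: "is_join m x y z" "is_join m x' y' z'" using join_exists xy by meson
  have "restr m eq z z'"
    using cong_join[OF c _ _ _ _ _ _ is_join_ins_last[OF _ _ z(1)] is_join_ins_last[OF _ _ z(2)]]
      xy e by (simp add: restr_def ins_Sn)
  then show "restr m eq (wjoin m x y) (wjoin m x' y')" using z by (simp add: wjoin_eq)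
  obtain z z' where z: "is_meet m x y z" "is_meet m x' y' z'" using meet_exists xy by meson
  have "restr m eq z z'"
    using cong_meet[OF c _ _ _ _ _ _ is_meet_ins_last[OF _ _ z(1), of "Suc m"]
        is_meet_ins_last[OF _ _ z(2), of "Suc m"]]
      xy e by (simp add: restr_def ins_Sn)
  then show "restr m eq (wmeet m x y) (wmeet m x' y')" using z by (simp add: wmeet_eq)
qed

text \<open>One common meet partner works for both: with \<open>r\<close> the join of the two
  deletions, meeting with \<open>ins r (Suc m)\<close> moves \<open>Suc m\<close> to the end of
  \<open>x\<close> and of \<open>y\<close>.\<close>

lemma restr_pdel:
  assumes c: "lattice_congruence (Suc m) eq" and x: "x \<in> Sn (Suc m)" and y: "y \<in> Sn (Suc m)"
    and e: "eq x y"
  shows "restr m eq (pdel (Suc m) x) (pdel (Suc m) y)"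
proof -
  let ?p = "pdel (Suc m)"
  have p: "?p x \<in> Sn m" "?p y \<in> Sn m" using x y by (simp_all add: pdel_Sn)
  then obtain r where r: "is_join m (?p x) (?p y) r" using join_exists by blast
  then have rS: "r \<in> Sn m" and le: "wle (?p x) r" "wle (?p y) r" by (simp_all add: is_join_def)
  have "is_meet (Suc m) (ins r (Suc m)) v (ins (?p v) (Suc m))"
    if "v \<in> Sn (Suc m)" "wle (?p v) r" for v
    using ins_pdel[OF that(1)] is_meet_ins_last[OF rS pdel_Sn[OF that(1)]]
      is_meet_absorb[OF pdel_Sn[OF that(1)] that(2)] is_meet_commute by metis
  from cong_meet[OF c _ _ x y _ e this[OF x le(1)] this[OF y le(2)]]
  show ?thesis using ins_Sn[OF rS] cong_refl[OF c] by (simp add: restr_def)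
qed

text \<open>Joining with \<open>ins (id_perm m) (Suc 0)\<close> moves \<open>Suc m\<close> from the
  end to the front on both rails.\<close>

lemma restr_first:
  assumes c: "lattice_congruence (Suc m) eq" and x: "x \<in> Sn m" and y: "y \<in> Sn m"
    and e: "restr m eq x y"
  shows "eq (ins x (Suc 0)) (ins y (Suc 0))"
  using cong_join[OF c _ _ _ _ _ _ is_join_ins_first[OF x id_perm_Sn wle_id_perm]
      is_join_ins_first[OF y id_perm_Sn wle_id_perm]] e x y cong_refl[OF c]
  by (simp add: restr_def ins_Sn id_perm_Sn)

text \<open>Moving \<open>z\<close> up to the rail over the join of \<open>pdel z\<close> and \<open>q\<close>, and then down to the rail
  over \<open>q\<close>, does not leave the class of \<open>z\<close>.\<close>

lemma class_meets_rail:
  assumes c: "lattice_congruence (Suc m) eq" and z: "z \<in> Sn (Suc m)" and q: "q \<in> Sn m"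
    and e: "restr m eq (pdel (Suc m) z) q"
  shows "\<exists>k\<in>{1..Suc m}. eq z (ins q k)"
proof -
  let ?p = "pdel (Suc m)"
  have cm: "lattice_congruence m (restr m eq)" using c by (rule restr_congruence)
  have p: "?p z \<in> Sn m" using z by (rule pdel_Sn)
  obtain r where r: "is_join m (?p z) q r" using join_exists p q by blast
  then have rS: "r \<in> Sn m" and le: "wle (?p z) r" "wle q r" by (simp_all add: is_join_def)
  have er: "restr m eq (?p z) r"
    using cong_join[OF cm p p p q cong_refl[OF cm p] e is_join_absorb[OF p wle_refl] r] .
  then have erq: "restr m eq r q"
    using cong_trans[OF cm rS p q cong_sym[OF cm p rS]] e by blast
  \<comment> \<open>Upwards: joining \<open>z\<close> with \<open>ins (?p z) (Suc m)\<close> gives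
    \<open>z\<close> again, while joining it with the equivalent \<open>ins r (Suc m)\<close> gives
    \<open>z'\<close>, which lies over \<open>r\<close>.\<close>
  obtain z' where z': "is_join (Suc m) z (ins r (Suc m)) z'"
    using join_exists z ins_Sn[OF rS] by blast
  then have z'S: "z' \<in> Sn (Suc m)" by (simp add: is_join_def)
  have "wle (ins (?p z) (Suc m)) z" using ins_pdel[OF z] wle_ins_last[OF p p] wle_refl by metis
  then have "is_join (Suc m) z (ins (?p z) (Suc m)) z"
    using is_join_absorb[OF z] is_join_commute by blast
  from cong_join[OF c z z ins_Sn[OF p] ins_Sn[OF rS] cong_refl[OF c z] _ this z']
  have ez: "eq z z'" using er unfolding restr_def .
  have "is_join m (?p z) r (?p z')"
    using is_join_pdel[OF z ins_Sn[OF rS] z'] by (simp add: pdel_ins[OF rS])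
  then have pz': "?p z' = r" using is_join_absorb[OF rS le(1)] is_join_unique by blast
  \<comment> \<open>Downwards: meeting \<open>z'\<close> with \<open>ins r (Suc 0)\<close> gives
    \<open>z'\<close> again, while meeting it with the equivalent \<open>ins q (Suc 0)\<close> gives
    \<open>z''\<close>, which lies over \<open>q\<close>.\<close>
  obtain z'' where z'': "is_meet (Suc m) z' (ins q (Suc 0)) z''"
    using meet_exists z'S ins_Sn[OF q] by blast
  then have z''S: "z'' \<in> Sn (Suc m)" by (simp add: is_meet_def)
  have "wle z' (ins r (Suc 0))"
    using ins_pdel[OF z'S] wle_ins_first[OF rS rS] wle_refl pz' by metis
  then have "is_meet (Suc m) z' (ins r (Suc 0)) z'" using is_meet_absorb[OF z'S] by blast
  then have ez': "eq z' z''"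
    using cong_meet[OF c z'S z'S _ _ cong_refl[OF c z'S] restr_first[OF c rS q erq] _ z'']
      ins_Sn[OF rS] ins_Sn[OF q] by blast
  have "is_meet m r q (?p z'')"
    using is_meet_pdel[OF z'S ins_Sn[OF q] z''] by (simp add: pdel_ins[OF q] pz')
  then have "?p z'' = q"
    using is_meet_absorb[OF q le(2)] is_meet_unique is_meet_commute by blast
  then obtain k where "k \<in> {1..Suc m}" "z'' = ins q k" using ins_pdel[OF z''S] by metis
  then show ?thesis using cong_trans[OF c z z'S z''S ez ez'] by blast
qed

text \<open>Meeting the last and the first end with \<open>ins (id_perm m) m\<close> gives the
  identity and \<open>ins (id_perm m) m\<close> itself, so equivalent ends would identify these
  two.\<close>

lemma rail_ends_inequiv:
  assumes c: "lattice_congruence (Suc m) eq" and x: "x \<in> Sn m"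
    and ne: "\<not> eq (id_perm (Suc m)) (ins (id_perm m) m)"
  shows "\<not> eq (ins x (Suc m)) (ins x (Suc 0))"
proof
  let ?s = "ins (id_perm m) m"
  assume e: "eq (ins x (Suc m)) (ins x (Suc 0))"
  have s: "?s \<in> Sn (Suc m)" by (simp add: ins_Sn id_perm_Sn)
  have "is_meet (Suc m) (ins x (Suc m)) ?s (id_perm (Suc m))"
    using is_meet_ins_last[OF x id_perm_Sn] is_meet_absorb[OF id_perm_Sn wle_id_perm]
      is_meet_commute id_perm_Suc by metis
  moreover have "is_meet (Suc m) (ins x (Suc 0)) ?s ?s"
    using is_meet_absorb[OF s] wle_ins_first[OF id_perm_Sn x] is_meet_commute by simp
  ultimately have "eq (id_perm (Suc m)) ?s"
    using cong_meet[OF c _ _ s s e cong_refl[OF c s]] ins_Sn[OF x] by blast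
  then show False using ne by blast
qed

lemma rail_equiv:
  assumes c: "lattice_congruence (Suc m) eq" and x: "x \<in> Sn m"
    and e: "eq (id_perm (Suc m)) (ins (id_perm m) m)" and i: "i \<in> {1..Suc m}"
  shows "eq (ins x (Suc m)) (ins x i)"
proof (cases m)
  case 0
  then show ?thesis using i cong_refl[OF c ins_Sn[OF x]] by auto
next
  case (Suc k)
  let ?s = "ins (id_perm m) m"
  \<comment> \<open>As \<open>m\<close> comes first in \<open>b\<close>, joining \<open>ins b (Suc m)\<close> with \<open>?s\<close> moves \<open>Suc m\<close> to the front, so the
    ends of the rail over \<open>b\<close> are equivalent. A meet carries this down to the rail over the identity,
    and joins carry it up to every other rail.\<close>
  define b where "b = ins (id_perm k) (Suc 0)"
  have bS: "b \<in> Sn m" unfolding b_def Suc by (simp add: ins_Sn id_perm_Sn)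
  have bI: "(m, a) \<in> invset b" if "a \<in> set b" "a \<noteq> m" for a
  proof -
    have "a \<in> set (id_perm k)" using that bS Suc by (auto simp: Sn_def id_perm_def)
    then show ?thesis unfolding b_def Suc using invset_ins[OF id_perm_Sn[of k]] by simp
  qed
  have s: "?s \<in> Sn (Suc m)" by (simp add: ins_Sn id_perm_Sn)
  have idS: "id_perm (Suc m) \<in> Sn (Suc m)" by (rule id_perm_Sn)
  have dm: "set (drop (m - 1) (id_perm m)) = {m}"
    unfolding id_perm_def Suc by (simp add: drop_map)
  have "is_join (Suc m) (ins b (Suc m)) ?s (ins b (Suc 0))"
    unfolding is_join_def
  proof (intro conjI ballI impI)
    show "ins b (Suc 0) \<in> Sn (Suc m)" using bS by (rule ins_Sn)
    show "wle (ins b (Suc m)) (ins b (Suc 0))" "wle ?s (ins b (Suc 0))"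
      using wle_ins_first[OF bS bS] wle_ins_first[OF id_perm_Sn bS] by simp_all
    fix w assume "w \<in> Sn (Suc m)" and w: "wle (ins b (Suc m)) w \<and> wle ?s w"
    then obtain t l where t: "t \<in> Sn m" "w = ins t l" by (metis Sn_cases)
    have bt: "wle b t" using w t bS by (simp add: wle_ins_last)
    have "set (drop (m - 1) (id_perm m)) \<subseteq> set (drop (l - 1) t)"
      using w unfolding t(2) using wle_ins_iff[OF id_perm_Sn t(1)] by blast
    then have mD: "m \<in> set (drop (l - 1) t)" using dm by simp
    \<comment> \<open>In \<open>t\<close>, the value \<open>m\<close> follows \<open>Suc m\<close>,
      and all other values follow \<open>m\<close> because the inversions \<open>(m, a)\<close> of
      \<open>b\<close> persist in \<open>t\<close>.\<close>
    have "set b \<subseteq> set (drop (l - 1) t)"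
    proof
      fix a assume a: "a \<in> set b"
      show "a \<in> set (drop (l - 1) t)"
      proof (cases "a = m")
        case False
        then have "(m, a) \<in> invset (take (l - 1) t @ drop (l - 1) t)"
          using bI a bt by (auto simp: wle_def)
        moreover have "distinct (take (l - 1) t @ drop (l - 1) t)" using t by (simp add: Sn_def)
        ultimately show ?thesis using mD invset_append_right by metis
      qed (use mD in simp)
    qed
    then show "wle (ins b (Suc 0)) w" using bt t bS by (simp add: wle_ins_iff)
  qed
  moreover have "is_join (Suc m) (ins b (Suc m)) (id_perm (Suc m)) (ins b (Suc m))"
    using is_join_absorb[OF ins_Sn[OF bS] wle_id_perm] is_join_commute by blast
  ultimately have eb: "eq (ins b (Suc m)) (ins b (Suc 0))"
    using cong_join[OF c _ _ idS s cong_refl[OF c] e] ins_Sn[OF bS] by blast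
  let ?t = "ins (id_perm m) (Suc 0)"
  have tS: "?t \<in> Sn (Suc m)" by (simp add: ins_Sn id_perm_Sn)
  have "is_meet (Suc m) (ins b (Suc m)) ?t (id_perm (Suc m))"
    using is_meet_ins_last[OF bS id_perm_Sn] is_meet_absorb[OF id_perm_Sn wle_id_perm]
      is_meet_commute id_perm_Suc by metis
  moreover have "is_meet (Suc m) (ins b (Suc 0)) ?t ?t"
    using is_meet_absorb[OF tS] wle_ins_first[OF id_perm_Sn bS] is_meet_commute by simp
  ultimately have et: "eq (id_perm (Suc m)) ?t"
    using cong_meet[OF c _ _ tS tS eb cong_refl[OF c tS]] ins_Sn[OF bS] by blast
  have xS: "ins x j \<in> Sn (Suc m)" for j using x by (rule ins_Sn)
  have "is_join (Suc m) (ins x (Suc m)) (id_perm (Suc m)) (ins x (Suc m))"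
    using is_join_absorb[OF xS wle_id_perm] is_join_commute by blast
  then have "eq (ins x (Suc m)) (ins x (Suc 0))"
    using cong_join[OF c xS xS idS tS cong_refl[OF c xS] et]
      is_join_ins_first[OF x id_perm_Sn wle_id_perm] by blast
  \<comment> \<open>The ends are equivalent; convexity gives the positions between them.\<close>
  then show ?thesis using cong_convex[OF c xS xS xS] wle_ins_rail[OF x, of i "Suc m"]
      wle_ins_rail[OF x, of "Suc 0" i] i by simp
qed

subsection \<open>Representatives joined by covers\<close>

text \<open>Some elements of the two classes have inversion sets that differ by at most one pair.
  Equality is allowed here and is ruled out later by inequivalence. This form passes directly from
  the restriction to both ends of the rails.\<close>

definition class_adj :: "nat \<Rightarrow> (perm \<Rightarrow> perm \<Rightarrow> bool) \<Rightarrow> perm \<Rightarrow> perm \<Rightarrow> bool" where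
  "class_adj n eq x y \<longleftrightarrow> (\<exists>x'\<in>Sn n. \<exists>y'\<in>Sn n. eq x x' \<and> eq y y' \<and>
     (\<exists>q. invset x' = insert q (invset y') \<or> invset y' = insert q (invset x')))"

lemma class_adj_sym: "class_adj n eq x y \<Longrightarrow> class_adj n eq y x"
  unfolding class_adj_def by blast

lemma cls_eqI:
  assumes c: "lattice_congruence n eq" and "x \<in> Sn n" "y \<in> Sn n" "eq x y"
  shows "cls n eq x = cls n eq y"
  unfolding cls_def
  using cong_trans[OF c] cong_sym[OF c] assms by blast

text \<open>A class strictly between would contain some \<open>w\<close> between \<open>x\<close>
  and \<open>y\<close>, but only \<open>x\<close> and \<open>y\<close> themselves have inversion
  sets in that range.\<close>

lemma qcover_of_insert:
  assumes c: "lattice_congruence n eq" and x: "x \<in> Sn n" and y: "y \<in> Sn n"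
    and ne: "\<not> eq x y" and ins: "invset y = insert q (invset x)"
  shows "qcover n eq (cls n eq x) (cls n eq y)"
  unfolding qcover_def
proof (intro conjI notI)
  show "cls n eq x \<in> classes n eq" "cls n eq y \<in> classes n eq"
    using x y by (auto simp: classes_def)
  have "x \<noteq> y" using ne cong_refl[OF c x] by auto
  then have "wlt x y" using ins by (auto simp: wlt_def wle_def)
  moreover have "x \<in> cls n eq x" "y \<in> cls n eq y" "y \<notin> cls n eq x"
    using x y ne cong_refl[OF c] by (auto simp: cls_def)
  ultimately show "qless (cls n eq x) (cls n eq y)" unfolding qless_def by blast
next
  assume "\<exists>Z\<in>classes n eq. qless (cls n eq x) Z \<and> qless Z (cls n eq y)"
  then obtain z where z: "z \<in> Sn n" and l1: "qless (cls n eq x) (cls n eq z)"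
    and l2: "qless (cls n eq z) (cls n eq y)" by (auto simp: classes_def)
  obtain x1 z1 where 1: "x1 \<in> Sn n" "eq x x1" "z1 \<in> Sn n" "eq z z1" "wle x1 z1"
    using l1 by (auto simp: qless_def cls_def wlt_def)
  obtain z3 y3 where 3: "y3 \<in> Sn n" "eq y y3" "z3 \<in> Sn n" "eq z z3" "wle z3 y3"
    using l2 by (auto simp: qless_def cls_def wlt_def)
  obtain z2 where z2: "is_join n x z1 z2" using join_exists x 1 by blast
  then have z2S: "z2 \<in> Sn n" and xz2: "wle x z2" by (simp_all add: is_join_def)
  have "eq z2 z1"
    using cong_join[OF c x 1(1) 1(3) 1(3) 1(2) cong_refl[OF c 1(3)] z2 is_join_absorb[OF 1(3,5)]] .
  then have e2: "eq z z2" using cong_trans[OF c z 1(3) z2S 1(4)] cong_sym[OF c z2S 1(3)] by blast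
  obtain z4 where z4: "is_meet n z3 y z4" using meet_exists y 3 by blast
  then have z4S: "z4 \<in> Sn n" and z4y: "wle z4 y" by (simp_all add: is_meet_def)
  have "eq z4 z3"
    using cong_meet[OF c 3(3) 3(3) y 3(1) cong_refl[OF c 3(3)] 3(2) z4 is_meet_absorb[OF 3(3,5)]] .
  then have e4: "eq z z4" using cong_trans[OF c z 3(3) z4S 3(4)] cong_sym[OF c z4S 3(3)] by blast
  have e24: "eq z2 z4" using cong_trans[OF c z2S z z4S] cong_sym[OF c z z2S e2] e4 by blast
  \<comment> \<open>\<open>z2\<close> is a member of the class above \<open>x\<close>, and
    \<open>z4\<close> is one below \<open>y\<close>. Meeting the equivalent \<open>z2\<close> and
    \<open>z4\<close> with \<open>y\<close> gives \<open>w\<close> and \<open>z4\<close>, so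
    \<open>w\<close> stays in the class and lies between \<open>x\<close> and
    \<open>y\<close>.\<close>
  obtain w where w: "is_meet n z2 y w" using meet_exists y z2S by blast
  then have wS: "w \<in> Sn n" and wy: "wle w y" by (simp_all add: is_meet_def)
  have xw: "wle x w" using w x xz2 ins by (auto simp: is_meet_def wle_def)
  have "eq w z4"
    using cong_meet[OF c z2S z4S y y e24 cong_refl[OF c y] w is_meet_absorb[OF z4S z4y]] .
  then have ew: "eq w z"
    using cong_trans[OF c wS z4S z] cong_sym[OF c z z4S e4] by blast
  have "invset w = invset x \<or> invset w = invset y"
    using xw wy ins unfolding wle_def by (cases "q \<in> invset w") auto
  then have "w = x \<or> w = y" using invset_inject wS x y by blast
  then have "cls n eq x = cls n eq z \<or> cls n eq y = cls n eq z"
    using cls_eqI[OF c _ z] ew x y by blast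
  then show False using l1 l2 by (auto simp: qless_def)
qed

lemma qadj_of_class_adj:
  assumes c: "lattice_congruence n eq" and x: "x \<in> Sn n" and y: "y \<in> Sn n"
    and ne: "\<not> eq x y" and a: "class_adj n eq x y"
  shows "qadj n eq (cls n eq x) (cls n eq y)"
proof -
  obtain x' y' q where xy': "x' \<in> Sn n" "y' \<in> Sn n" "eq x x'" "eq y y'"
    and q: "invset x' = insert q (invset y') \<or> invset y' = insert q (invset x')"
    using a unfolding class_adj_def by blast
  have "\<not> eq x' y'"
    using cong_trans[OF c] cong_sym[OF c] xy' x y ne by metis
  moreover from this have "\<not> eq y' x'" using cong_sym[OF c] xy' by blast
  moreover have "cls n eq x = cls n eq x'" "cls n eq y = cls n eq y'"
    using cls_eqI[OF c] xy' x y by blast+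
  ultimately show ?thesis
    using q qcover_of_insert[OF c] xy'(1,2) unfolding qadj_def by metis
qed

text \<open>At either end the set of values to the right of \<open>Suc m\<close> is the same for all
  permutations, empty or full, so no further inversion separates the lifts.\<close>

lemma class_adj_lift:
  assumes c: "lattice_congruence (Suc m) eq" and x: "x \<in> Sn m" and y: "y \<in> Sn m"
    and a: "class_adj m (restr m eq) x y" and e: "e \<in> {Suc 0, Suc m}"
  shows "class_adj (Suc m) eq (ins x e) (ins y e)"
proof -
  obtain x' y' q where xy': "x' \<in> Sn m" "y' \<in> Sn m" "restr m eq x x'" "restr m eq y y'"
    and q: "invset x' = insert q (invset y') \<or> invset y' = insert q (invset x')"
    using a unfolding class_adj_def by blast
  have "eq (ins x e) (ins x' e)" "eq (ins y e) (ins y' e)"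
    using e xy' restr_first[OF c] x y by (auto simp: restr_def)
  moreover have "set (drop (e - 1) x') = set (drop (e - 1) y')"
    using e xy'(1,2) by (auto simp: Sn_length) (simp_all add: Sn_def)
  then have "\<exists>q. invset (ins x' e) = insert q (invset (ins y' e)) \<or>
      invset (ins y' e) = insert q (invset (ins x' e))"
    using q unfolding invset_ins[OF xy'(1)] invset_ins[OF xy'(2)] by (metis Un_insert_left)
  ultimately show ?thesis
    using ins_Sn xy'(1,2) unfolding class_adj_def by blast
qed

text \<open>By \<open>reps\<close>, each class on the rail has an element outside the gap between
  \<open>i\<close> and \<open>j\<close>. As classes are intervals on the rail, those of
  \<open>i\<close> and \<open>j\<close> must then touch inside the gap.\<close>

lemma class_adj_rail:
  assumes c: "lattice_congruence (Suc m) eq" and x: "x \<in> Sn m"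
    and ij: "1 \<le> j" "j < i" "i \<le> Suc m" and ne: "\<not> eq (ins x i) (ins x j)"
    and reps: "\<And>k. k \<in> {1..Suc m} \<Longrightarrow> \<exists>l\<in>{1..Suc m}. l \<notin> {j<..<i} \<and> eq (ins x k) (ins x l)"
  shows "class_adj (Suc m) eq (ins x i) (ins x j)"
proof -
  have xS: "ins x k \<in> Sn (Suc m)" for k using x by (rule ins_Sn)
  \<comment> \<open>The place where the rail, followed from \<open>i\<close> down to
    \<open>j\<close>, first leaves the class of \<open>ins x i\<close>.\<close>
  obtain k where k: "j \<le> k" "k < i" "eq (ins x i) (ins x (Suc k))" "\<not> eq (ins x i) (ins x k)"
  proof -
    have "eq (ins x i) (ins x j)"
      if "\<And>k. j \<le> k \<Longrightarrow> k < i \<Longrightarrow> eq (ins x i) (ins x (Suc k)) \<Longrightarrow> eq (ins x i) (ins x k)"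
      using less_imp_le[OF ij(2)]
      by (induction rule: inc_induct) (use that cong_refl[OF c xS] in auto)
    then show thesis using that ne by blast
  qed
  obtain l where l: "l \<notin> {j<..<i}" "eq (ins x k) (ins x l)"
    using reps[of k] k ij by auto
  have sym: "eq (ins x b) (ins x a)" if "eq (ins x a) (ins x b)" for a b
    using cong_sym[OF c xS xS that] .
  have conv: "eq (ins x d) (ins x b)" if "eq (ins x d) (ins x a)" "a \<le> b" "b \<le> d" for a b d
    using cong_convex[OF c xS xS xS _ _ that(1)] wle_ins_rail[OF x] that by blast
  have "\<not> i \<le> l"
  proof
    assume "i \<le> l"
    then have "eq (ins x l) (ins x i)" using conv[OF sym[OF l(2)]] k by simp
    then have "eq (ins x k) (ins x i)" using cong_trans[OF c xS xS xS l(2)] by blast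
    then show False using sym k(4) by blast
  qed
  then have lj: "l \<le> j" using l by auto
  then have "eq (ins x k) (ins x j)" using conv[OF l(2)] k by blast
  then have "eq (ins x j) (ins x k)" by (rule sym)
  \<comment> \<open>Moving \<open>Suc m\<close> from position \<open>Suc k\<close> to
    \<open>k\<close> adds one inversion, with the entry passed; its list index is
    \<open>k - 1\<close>.\<close>
  moreover have km: "k - 1 < length x" using Sn_length[OF x] k ij by auto
  then have "drop (k - 1) x = x ! (k - 1) # drop k x"
    using Cons_nth_drop_Suc[OF km] k ij by simp
  then have "invset (ins x k) = insert (Suc m, x ! (k - 1)) (invset (ins x (Suc k)))"
    unfolding invset_ins[OF x] by simp
  ultimately show ?thesis using k(3) xS unfolding class_adj_def by blast
qed

subsection \<open>Jumps\<close>

lemma pos_less: "v \<in> set x \<Longrightarrow> pos x v < length x"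
  unfolding pos_def by (induction x) auto

text \<open>A jump passes only entries below \<open>v\<close>, so the larger \<open>n\<close> at the
  end acts as a wall.\<close>

lemma jump_snoc_max:
  assumes "v \<in> set x" "v < n"
  shows "jump (x @ [n]) v dir d = map_option (\<lambda>y. y @ [n]) (jump x v dir d)"
proof -
  have p: "pos (x @ [n]) v = pos x v" unfolding pos_def using assms by simp
  have l: "pos x v < length x" using assms(1) by (rule pos_less)
  show ?thesis
  proof (cases dir)
    case JRight
    have "(pos x v + d < length (x @ [n]) \<and> (\<forall>k\<in>{Suc (pos x v)..pos x v + d}. (x @ [n]) ! k < v))
      \<longleftrightarrow> (pos x v + d < length x \<and> (\<forall>k\<in>{Suc (pos x v)..pos x v + d}. x ! k < v))" (is "?A \<longleftrightarrow> ?B")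
    proof
      assume A: ?A
      have "pos x v + d \<noteq> length x"
      proof
        assume "pos x v + d = length x"
        then have "(x @ [n]) ! length x < v"
          using bspec[OF conjunct2[OF A], of "length x"] l by simp
        then show False using assms(2) by simp
      qed
      then show ?B using A by (auto simp: nth_append)
    qed (auto simp: nth_append)
    then show ?thesis using assms l unfolding jump_def JRight p by (auto simp: Let_def)
  next
    case JLeft
    have "(\<forall>k\<in>{pos x v - d..<pos x v}. (x @ [n]) ! k < v) \<longleftrightarrow>
      (\<forall>k\<in>{pos x v - d..<pos x v}. x ! k < v)" using l by (auto simp: nth_append)
    then show ?thesis using assms l unfolding jump_def JLeft p by (auto simp: Let_def)
  qed
qed

text \<open>Here all positions shift by one, and the wall excludes the left jump that would reach
  position \<open>0\<close>.\<close>

lemma jump_Cons_max: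
  assumes "v \<in> set x" "v < n"
  shows "jump (n # x) v dir d = map_option (Cons n) (jump x v dir d)"
proof -
  have p: "pos (n # x) v = Suc (pos x v)" unfolding pos_def using assms by simp
  have l: "pos x v < length x" using assms(1) by (rule pos_less)
  show ?thesis
  proof (cases dir)
    case JRight
    have "(\<forall>k\<in>{Suc (Suc (pos x v))..Suc (pos x v) + d}. (n # x) ! k < v)
      \<longleftrightarrow> (\<forall>k\<in>{Suc (pos x v)..pos x v + d}. x ! k < v)"
      by (simp only: add_Suc image_Suc_atLeastAtMost[symmetric] ball_simps nth_Cons_Suc)
    then show ?thesis using assms l unfolding jump_def JRight p by (auto simp: Let_def)
  next
    case JLeft
    have "(d \<le> Suc (pos x v) \<and> (\<forall>k\<in>{Suc (pos x v) - d..<Suc (pos x v)}. (n # x) ! k < v)) \<longleftrightarrow>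
      (d \<le> pos x v \<and> (\<forall>k\<in>{pos x v - d..<pos x v}. x ! k < v))" (is "?A \<longleftrightarrow> ?B")
    proof
      assume A: ?A
      have d: "d \<le> pos x v"
      proof (rule ccontr)
        assume "\<not> d \<le> pos x v"
        then have "(n # x) ! 0 < v" using A by (intro bspec[OF conjunct2[OF A]]) auto
        then show False using assms(2) by simp
      qed
      have "x ! k < v" if "k \<in> {pos x v - d..<pos x v}" for k
        using bspec[OF conjunct2[OF A], of "Suc k"] that d by (auto simp: Suc_diff_le)
      then show ?B using d by blast
    next
      assume B: ?B
      have "(n # x) ! k < v" if "k \<in> {Suc (pos x v) - d..<Suc (pos x v)}" for k
      proof (cases k)
        case (Suc k')
        then show ?thesis using B that by (auto simp: Suc_diff_le)
      qed (use that B in auto)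
      then show ?A using B by auto
    qed
    moreover have "Suc (pos x v) - d = Suc (pos x v - d)" if "d \<le> pos x v"
      using that by (simp add: Suc_diff_le)
    ultimately show ?thesis using assms unfolding jump_def JLeft p by (auto simp: Let_def)
  qed
qed

text \<open>Every other entry is smaller than \<open>Suc m\<close>, so only the list boundaries
  limit its jumps, which run along the rail.\<close>

lemma jump_ins:
  assumes x: "x \<in> Sn m" and i: "i \<in> {1..Suc m}"
  shows "jump (ins x i) (Suc m) JRight d =
      (if 0 < d \<and> i + d \<le> Suc m then Some (ins x (i + d)) else None)"
    and "jump (ins x i) (Suc m) JLeft d =
      (if 0 < d \<and> d < i then Some (ins x (i - d)) else None)"
proof -
  obtain u v where uv: "x = u @ v" "ins x i = u @ Suc m # v" "v = drop (i - 1) x"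
    "set u \<union> set v = {1..m}" "Suc m \<notin> set u"
    using x by (rule ins_decomp[where i = i])
  have lx: "length u + length v = m" using Sn_length[OF x] uv(1) by simp
  have "length v = m - (i - 1)" using uv(3) Sn_length[OF x] by (metis length_drop)
  then have li: "i = Suc (length u)" using lx i by (simp only: atLeastAtMost_iff) arith
  have p: "pos (ins x i) (Suc m) = length u"
  proof -
    have "takeWhile (\<lambda>a. a \<noteq> Suc m) (u @ Suc m # v) = u"
      using uv(5) by (subst takeWhile_append2) auto
    then show ?thesis unfolding uv(2) pos_def by simp
  qed
  have lt: "(u @ Suc m # v) ! k < Suc m" if "k \<noteq> length u" "k < Suc (length u + length v)" for k
  proof -
    have "(u @ Suc m # v) ! k \<in> set u \<union> set v"
      using that by (auto simp: nth_append nth_Cons split: nat.split)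
    then show ?thesis using uv(4) by auto
  qed
  have insx: "ins x (Suc k) = take k (u @ v) @ Suc m # drop k (u @ v)" for k
    using uv(1) lx by (simp add: ins_def)
  show "jump (ins x i) (Suc m) JRight d =
      (if 0 < d \<and> i + d \<le> Suc m then Some (ins x (i + d)) else None)"
    unfolding jump_def p using lx lt by (auto simp: Let_def uv(2) li insx)
  have "ins x (i - d) = take (length u - d) u @ [Suc m] @ drop (length u - d) u @ v"
    if "d < i"
  proof -
    have "i - d = Suc (length u - d)" using that li by simp
    then show ?thesis using insx[of "length u - d"] by simp
  qed
  then show "jump (ins x i) (Suc m) JLeft d =
      (if 0 < d \<and> d < i then Some (ins x (i - d)) else None)"
    unfolding jump_def p using lx lt by (auto simp: Let_def uv(2)[unfolded li] li)
qed

section \<open>Minimal jumps\<close>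

lemma min_jumpD: "min_jump L x v dir = Some y \<Longrightarrow> y \<in> L \<and> (\<exists>d. jump x v dir d = Some y)"
proof -
  assume a: "min_jump L x v dir = Some y"
  then obtain d where "jump_ok L x v dir d" unfolding min_jump_def by (auto split: if_splits)
  then have "jump_ok L x v dir (LEAST d. jump_ok L x v dir d)" by (rule LeastI)
  then show ?thesis using a unfolding min_jump_def jump_ok_def by (auto split: if_splits)
qed

lemma min_jumpI:
  assumes "jump x v dir d = Some y" "y \<in> L"
    and "\<And>d' y'. d' < d \<Longrightarrow> jump x v dir d' = Some y' \<Longrightarrow> y' \<notin> L"
  shows "min_jump L x v dir = Some y"
proof -
  have ok: "jump_ok L x v dir d" using assms by (simp add: jump_ok_def)
  have "(LEAST d. jump_ok L x v dir d) = d"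
    using ok assms(3) by (intro Least_equality) (auto simp: jump_ok_def intro: leI)
  then show ?thesis using ok assms(1) by (auto simp: min_jump_def)
qed

text \<open>Used with \<open>f\<close> adding the maximum at an end. The second premise ranges over
  all lists, which is why \<open>f\<close> will be a plain list operation and not
  \<open>ins\<close>.\<close>

lemma min_jump_map:
  assumes "\<And>d. jump x' v dir d = map_option f (jump x v dir d)"
    and "\<And>y. f y \<in> L \<longleftrightarrow> y \<in> L'"
  shows "min_jump L x' v dir = map_option f (min_jump L' x v dir)"
proof -
  have "jump_ok L x' v dir = jump_ok L' x v dir"
    using assms by (auto simp: fun_eq_iff jump_ok_def)
  then show ?thesis by (simp add: min_jump_def assms(1))
qed

subsection \<open>The steps of Algorithm J\<close>

text \<open>The local function \<open>cand\<close> of \<open>J_next\<close> as a constant;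
  \<open>jstep\<close> is the choice of direction for the selected value.\<close>

definition jcand :: "perm set \<Rightarrow> perm list \<Rightarrow> nat \<Rightarrow> jdir \<Rightarrow> perm option" where
  "jcand L vs v dir = (case min_jump L (last vs) v dir of
     None \<Rightarrow> None | Some y \<Rightarrow> if y \<in> set vs then None else Some y)"

definition jstep :: "perm set \<Rightarrow> perm list \<Rightarrow> nat \<Rightarrow> perm option" where
  "jstep L vs v =
     (if jcand L vs v JLeft \<noteq> None \<and> jcand L vs v JRight \<noteq> None then None
      else if jcand L vs v JLeft \<noteq> None then jcand L vs v JLeft else jcand L vs v JRight)"

lemma J_next_alt:
  "J_next L n vs = (case filter (\<lambda>v. jcand L vs v JLeft \<noteq> None \<or> jcand L vs v JRight \<noteq> None)
     (rev [2..<Suc n]) of [] \<Rightarrow> None | v # _ \<Rightarrow> jstep L vs v)"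
  unfolding J_next_def jcand_def jstep_def Let_def ..

lemma jcandD: "jcand L vs v dir = Some y \<Longrightarrow> y \<in> L \<and> y \<notin> set vs"
  unfolding jcand_def using min_jumpD by (auto split: option.splits if_splits)

lemma J_nextD: "J_next L n vs = Some y \<Longrightarrow> y \<in> L \<and> y \<notin> set vs"
  unfolding J_next_alt jstep_def using jcandD by (auto split: list.splits if_splits)

lemma J_next_max:
  assumes "2 \<le> n" "jcand L vs n JLeft \<noteq> None \<or> jcand L vs n JRight \<noteq> None"
  shows "J_next L n vs = jstep L vs n"
  using assms by (simp add: J_next_alt)

text \<open>Since \<open>map_option\<close> keeps \<open>None\<close>, both sides select the same
  value and agree on whether both directions are possible.\<close>

lemma J_next_less_max:
  assumes "jcand L vs (Suc m) JLeft = None" "jcand L vs (Suc m) JRight = None"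
    and cand: "\<And>v dir. v \<in> {2..m} \<Longrightarrow> jcand L vs v dir = map_option f (jcand L' vs' v dir)"
  shows "J_next L (Suc m) vs = map_option f (J_next L' m vs')"
proof -
  let ?P = "\<lambda>v. jcand L vs v JLeft \<noteq> None \<or> jcand L vs v JRight \<noteq> None"
  let ?P' = "\<lambda>v. jcand L' vs' v JLeft \<noteq> None \<or> jcand L' vs' v JRight \<noteq> None"
  have "filter ?P (rev [2..<Suc (Suc m)]) = filter ?P (rev [2..<Suc m])"
    using assms(1,2) by (cases "2 \<le> Suc m") simp_all
  also have "\<dots> = filter ?P' (rev [2..<Suc m])"
    using cand by (intro filter_cong) auto
  finally have f: "filter ?P (rev [2..<Suc (Suc m)]) = filter ?P' (rev [2..<Suc m])" .
  show ?thesis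
  proof (cases "filter ?P' (rev [2..<Suc m])")
    case Nil
    then show ?thesis unfolding J_next_alt f by simp
  next
    case (Cons v ws)
    then have "v \<in> set (filter ?P' (rev [2..<Suc m]))" by simp
    then have "v \<in> {2..m}" by auto
    then have "jstep L vs v = map_option f (jstep L' vs' v)"
      unfolding jstep_def using cand by auto
    then show ?thesis unfolding J_next_alt f Cons by simp
  qed
qed

text \<open>The stepping condition of \<open>J_run\<close> without termination; prefixes inherit it,
  so runs can be built by appending.\<close>

definition J_path :: "perm set \<Rightarrow> nat \<Rightarrow> perm list \<Rightarrow> bool" where
  "J_path L n ps \<longleftrightarrow> (\<forall>us y ws. ps = us @ y # ws \<longrightarrow> us \<noteq> [] \<longrightarrow> J_next L n us = Some y)"

lemma J_run_iff_J_path: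
  "J_run L n x0 ps \<longleftrightarrow> ps \<noteq> [] \<and> hd ps = x0 \<and> J_path L n ps \<and> J_next L n ps = None"
proof -
  have "(\<forall>i. 0 < i \<and> i < length ps \<longrightarrow> J_next L n (take i ps) = Some (ps ! i)) \<longleftrightarrow> J_path L n ps"
    (is "?A \<longleftrightarrow> _")
  proof
    assume a: ?A
    show "J_path L n ps"
      unfolding J_path_def
    proof (intro allI impI)
      fix us y ws assume "ps = us @ y # ws" "us \<noteq> []"
      then show "J_next L n us = Some y" using a[rule_format, of "length us"] by simp
    qed
  next
    assume p: "J_path L n ps"
    show ?A
    proof (intro allI impI)
      fix i assume i: "0 < i \<and> i < length ps"
      then have "ps = take i ps @ ps ! i # drop (Suc i) ps" by (simp add: id_take_nth_drop)
      then show "J_next L n (take i ps) = Some (ps ! i)"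
        using p i unfolding J_path_def by (metis length_greater_0_conv list.size(3) not_less_zero take_eq_Nil less_irrefl)
    qed
  qed
  then show ?thesis unfolding J_run_def by blast
qed

lemma J_path_appendI:
  assumes us: "J_path L n us"
    and vs: "\<And>as z bs. vs = as @ z # bs \<Longrightarrow> us @ as \<noteq> [] \<Longrightarrow> J_next L n (us @ as) = Some z"
  shows "J_path L n (us @ vs)"
  unfolding J_path_def
proof (intro allI impI)
  fix as z bs assume e: "us @ vs = as @ z # bs" and ne: "as \<noteq> []"
  from e consider cs where "us = as @ cs" "cs @ vs = z # bs" | cs where "us @ cs = as" "vs = cs @ z # bs"
    by (auto simp: append_eq_append_conv2)
  then show "J_next L n as = Some z"
  proof cases
    case 1
    show ?thesis
    proof (cases cs)
      case Nil
      then show ?thesis using 1 vs[of "[]" z bs] ne by simp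
    next
      case (Cons c cs')
      then show ?thesis using 1 us ne unfolding J_path_def by auto
    qed
  next
    case 2
    then show ?thesis using vs ne by blast
  qed
qed

lemma J_path_prefix: "J_path L n (us @ vs) \<Longrightarrow> J_path L n us"
  unfolding J_path_def by auto

lemma J_path_distinct: "J_path L n ps \<Longrightarrow> distinct ps"
proof (induction ps rule: rev_induct)
  case (snoc y ps)
  show ?case
  proof (cases "ps = []")
    case False
    then have "J_next L n ps = Some y" using snoc.prems unfolding J_path_def by blast
    then show ?thesis using snoc J_path_prefix J_nextD by auto
  qed simp
qed simp

subsection \<open>Rails\<close>

text \<open>If \<open>b\<close> holds, the rail runs from the last position leftwards, otherwise from the first
  position rightwards.\<close>

definition rail :: "perm set \<Rightarrow> nat \<Rightarrow> perm \<Rightarrow> bool \<Rightarrow> perm list" where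
  "rail L m x b = map (ins x)
     ((if b then rev else id) (filter (\<lambda>i. ins x i \<in> L) [1..<Suc (Suc m)]))"

lemma set_rail: "set (rail L m x b) = {ins x i | i. i \<in> {1..Suc m} \<and> ins x i \<in> L}"
  unfolding rail_def by (auto simp: image_iff simp del: upt_Suc)

lemma rail_ends:
  assumes "ins x (Suc 0) \<in> L" "ins x (Suc m) \<in> L"
  shows "rail L m x b \<noteq> []"
    and "hd (rail L m x b) = ins x (if b then Suc m else Suc 0)"
    and "last (rail L m x b) = ins x (if b then Suc 0 else Suc m)"
proof -
  let ?f = "filter (\<lambda>i. ins x i \<in> L) [1..<Suc (Suc m)]"
  have "?f = Suc 0 # filter (\<lambda>i. ins x i \<in> L) [2..<Suc (Suc m)]"
    using assms(1) by (subst upt_conv_Cons) (simp_all add: numeral_2_eq_2 del: upt_Suc)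
  then have f: "?f \<noteq> []" "hd ?f = Suc 0" by simp_all
  have l: "last ?f = Suc m" using assms(2) by simp
  show "rail L m x b \<noteq> []" using f by (simp add: rail_def del: upt_Suc)
  show "hd (rail L m x b) = ins x (if b then Suc m else Suc 0)"
    using f l by (simp add: rail_def hd_map hd_rev del: upt_Suc filter.simps)
  show "last (rail L m x b) = ins x (if b then Suc 0 else Suc m)"
    using f l by (simp add: rail_def last_map last_rev del: upt_Suc filter.simps)
qed

text \<open>The positions along a rail are strictly monotone. The last three facts serve, in order,
  to show that the jump from \<open>y\<close> to \<open>z\<close> is minimal, that nothing unvisited
  lies behind \<open>y\<close>, and that \<open>z\<close> is new.\<close>

lemma rail_consecutive:
  assumes "rail L m x b = us @ y # z # ws"
  obtains i j where "y = ins x i" "z = ins x j" "i \<in> {1..Suc m}" "j \<in> {1..Suc m}" "y \<in> L" "z \<in> L"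
    "if b then j < i else i < j"
    "\<And>k. k \<in> {1..Suc m} \<Longrightarrow> ins x k \<in> L \<Longrightarrow> (if b then k < i else i < k) \<Longrightarrow>
       (if b then k \<le> j else j \<le> k)"
    "\<And>k. k \<in> {1..Suc m} \<Longrightarrow> ins x k \<in> L \<Longrightarrow> (if b then i \<le> k else k \<le> i) \<Longrightarrow>
       ins x k \<in> set (us @ [y])"
    "\<And>a. a \<in> set (us @ [y]) \<Longrightarrow> \<exists>k\<in>{1..Suc m}. a = ins x k \<and> (if b then i \<le> k else k \<le> i)"
proof -
  let ?r = "\<lambda>i j :: nat. if b then j < i else i < j"
  define ks where "ks = (if b then rev else id) (filter (\<lambda>i. ins x i \<in> L) [1..<Suc (Suc m)])"
  have set_ks: "k \<in> set ks \<longleftrightarrow> k \<in> {1..Suc m} \<and> ins x k \<in> L" for k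
    unfolding ks_def by (auto simp del: upt_Suc)
  have sw: "sorted_wrt ?r ks"
    unfolding ks_def by (auto simp: sorted_wrt_rev sorted_wrt_filter simp del: upt_Suc)
  have "map (ins x) ks = us @ y # z # ws" using assms unfolding rail_def ks_def .
  then obtain ks1 i j ks2 where s: "ks = ks1 @ i # j # ks2" "us = map (ins x) ks1"
    "y = ins x i" "z = ins x j"
    by (auto simp: map_eq_append_conv map_eq_Cons_conv)
  show thesis
  proof
    show "y = ins x i" "z = ins x j" using s by simp_all
    show "i \<in> {1..Suc m}" "j \<in> {1..Suc m}" "y \<in> L" "z \<in> L"
      using set_ks[of i] set_ks[of j] s by simp_all
    show "?r i j" using sw s by (simp add: sorted_wrt_append)
  next
    fix k assume k: "k \<in> {1..Suc m}" "ins x k \<in> L" "?r i k"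
    then have "k \<in> set ks" using set_ks by blast
    then show "if b then k \<le> j else j \<le> k"
      using sw k(3) s by (cases b) (fastforce simp: sorted_wrt_append)+
  next
    fix k assume k: "k \<in> {1..Suc m}" "ins x k \<in> L" "if b then i \<le> k else k \<le> i"
    then have "k \<in> set ks" using set_ks by blast
    then have "k \<in> set (ks1 @ [i])"
      using sw k(3) s by (cases b) (fastforce simp: sorted_wrt_append)+
    then show "ins x k \<in> set (us @ [y])" using s by auto
  next
    fix a assume "a \<in> set (us @ [y])"
    then obtain k where k: "k \<in> set (ks1 @ [i])" "a = ins x k" using s by auto
    then have "if b then i \<le> k else k \<le> i"
      using sw s by (cases b) (fastforce simp: sorted_wrt_append)+
    moreover have "k \<in> {1..Suc m}" using set_ks[of k] k s by auto
    ultimately show "\<exists>k\<in>{1..Suc m}. a = ins x k \<and> (if b then i \<le> k else k \<le> i)" using k by blast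
  qed
qed

text \<open>All jumps of \<open>Suc m\<close> stay on the rail, so visiting its elements of
  \<open>L\<close> on one side exhausts that direction.\<close>

lemma jcand_max_None:
  assumes x: "x \<in> Sn m" and i: "i \<in> {1..Suc m}" "last vs = ins x i"
    and vis: "\<And>k. k \<in> {1..Suc m} \<Longrightarrow> ins x k \<in> L \<Longrightarrow> (if dir = JLeft then k < i else i < k) \<Longrightarrow>
      ins x k \<in> set vs"
  shows "jcand L vs (Suc m) dir = None"
proof (cases "min_jump L (last vs) (Suc m) dir")
  case (Some y)
  then obtain d where y: "y \<in> L" "jump (ins x i) (Suc m) dir d = Some y"
    using min_jumpD i(2) by metis
  have "y \<in> set vs"
  proof (cases dir)
    case JLeft
    then have "0 < d" "d < i" "y = ins x (i - d)"
      using y jump_ins(2)[OF x i(1), of d] by (auto split: if_splits)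
    moreover from this have "i - d \<in> {1..Suc m}" using i(1) by (simp only: atLeastAtMost_iff) arith
    ultimately show ?thesis using vis[of "i - d"] y(1) JLeft by simp
  next
    case JRight
    then have "0 < d" "i + d \<le> Suc m" "y = ins x (i + d)"
      using y jump_ins(1)[OF x i(1), of d] by (auto split: if_splits)
    then show ?thesis using vis[of "i + d"] y(1) i(1) JRight by simp
  qed
  then show ?thesis using Some by (simp add: jcand_def)
qed (simp add: jcand_def)

text \<open>Inside a rail the maximum is the first value tried and keeps its direction. The bound on
  \<open>m\<close> makes \<open>Suc m\<close> at least \<open>2\<close>, the smallest value that
  Algorithm J considers.\<close>

lemma J_next_rail:
  assumes x: "x \<in> Sn m" and m: "1 \<le> m"
    and r: "rail L m x b = us @ z # ws" "us \<noteq> []"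
    and pre: "\<And>k. k \<in> {1..Suc m} \<Longrightarrow> ins x k \<notin> set pre"
  shows "J_next L (Suc m) (pre @ us) = Some z"
proof -
  obtain us' y where us: "us = us' @ [y]" using r(2) by (metis rev_exhaust)
  then have "rail L m x b = us' @ y # z # ws" using r by simp
  then obtain i j where ij: "y = ins x i" "z = ins x j" "i \<in> {1..Suc m}" "j \<in> {1..Suc m}"
    "y \<in> L" "z \<in> L" "if b then j < i else i < j"
    and btw: "\<And>k. k \<in> {1..Suc m} \<Longrightarrow> ins x k \<in> L \<Longrightarrow> (if b then k < i else i < k) \<Longrightarrow>
       (if b then k \<le> j else j \<le> k)"
    and vis: "\<And>k. k \<in> {1..Suc m} \<Longrightarrow> ins x k \<in> L \<Longrightarrow> (if b then i \<le> k else k \<le> i) \<Longrightarrow>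
       ins x k \<in> set (us' @ [y])"
    and sub: "\<And>a. a \<in> set (us' @ [y]) \<Longrightarrow>
       \<exists>k\<in>{1..Suc m}. a = ins x k \<and> (if b then i \<le> k else k \<le> i)"
    by (rule rail_consecutive) blast
  have la: "last (pre @ us) = ins x i" using us ij by simp
  define dir where "dir = (if b then JLeft else JRight)"
  define opp where "opp = (if b then JRight else JLeft)"
  have z: "z \<notin> set (pre @ us)"
  proof
    assume "z \<in> set (pre @ us)"
    then have "z \<in> set (us' @ [y])" using pre ij us by auto
    then obtain k where "k \<in> {1..Suc m}" "ins x j = ins x k" "if b then i \<le> k else k \<le> i"
      using sub ij(2) by blast
    then show False using ins_inj[OF x ij(4)] ij(7) by (auto split: if_splits)
  qed
  have "min_jump L (ins x i) (Suc m) dir = Some z"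
  proof (cases b)
    case True
    have "ins x (i - d') \<notin> L" if "0 < d'" "d' < i - j" for d'
    proof
      assume "ins x (i - d') \<in> L"
      moreover have "i - d' \<in> {1..Suc m}"
        using that ij(3,4) by (simp only: atLeastAtMost_iff) arith
      ultimately have "i - d' \<le> j" using btw[of "i - d'"] True that by auto
      then show False using that by auto
    qed
    then show ?thesis
      unfolding dir_def using True ij
      by (intro min_jumpI[where d = "i - j"]) (auto simp: jump_ins(2)[OF x ij(3)] split: if_splits)
  next
    case False
    have "ins x (i + d') \<notin> L" if "0 < d'" "d' < j - i" for d'
    proof
      assume "ins x (i + d') \<in> L"
      then have "j \<le> i + d'" using btw[of "i + d'"] False that ij(3,4) by auto
      then show False using that by auto
    qed
    then show ?thesis
      unfolding dir_def using False ij
      by (intro min_jumpI[where d = "j - i"]) (auto simp: jump_ins(1)[OF x ij(3)] split: if_splits)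
  qed
  then have c1: "jcand L (pre @ us) (Suc m) dir = Some z" using z by (simp only: jcand_def la) simp
  \<comment> \<open>Everything behind \<open>y\<close> is visited, so the algorithm does not stop
    for having two directions.\<close>
  have c2: "jcand L (pre @ us) (Suc m) opp = None"
  proof (rule jcand_max_None[OF x ij(3) la])
    fix k assume "k \<in> {1..Suc m}" "ins x k \<in> L" "if opp = JLeft then k < i else i < k"
    then have "ins x k \<in> set us"
      using vis[of k] unfolding opp_def us by (auto split: if_splits)
    then show "ins x k \<in> set (pre @ us)" by simp
  qed
  have "J_next L (Suc m) (pre @ us) = jstep L (pre @ us) (Suc m)"
    using m c1 unfolding dir_def by (intro J_next_max) (auto split: if_splits)
  also have "\<dots> = Some z" using c1 c2 unfolding jstep_def dir_def opp_def by (auto split: if_splits)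
  finally show ?thesis .
qed

subsection \<open>Algorithm J on a zigzag language\<close>

text \<open>Indices start at \<open>0\<close>, so the first rail runs leftwards from the last
  position, where the identity lies.\<close>

definition zigzag_expand :: "perm set \<Rightarrow> nat \<Rightarrow> perm list \<Rightarrow> perm list" where
  "zigzag_expand L m vs = concat (map (\<lambda>k. rail L m (vs ! k) (even k)) [0..<length vs])"

lemma zigzag_expand_Nil [simp]: "zigzag_expand L m [] = []"
  by (simp add: zigzag_expand_def)

lemma zigzag_expand_snoc:
  "zigzag_expand L m (vs @ [y]) = zigzag_expand L m vs @ rail L m y (even (length vs))"
proof -
  have "map (\<lambda>k. rail L m ((vs @ [y]) ! k) (even k)) [0..<length vs] =
    map (\<lambda>k. rail L m (vs ! k) (even k)) [0..<length vs]"
    by (rule map_cong[OF refl]) (simp add: nth_append)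
  then show ?thesis by (simp add: zigzag_expand_def del: map_eq_conv)
qed

lemma set_zigzag_expand:
  "set (zigzag_expand L m vs) = {ins x i | x i. x \<in> set vs \<and> i \<in> {1..Suc m} \<and> ins x i \<in> L}"
  by (induction vs rule: rev_induct) (auto simp: zigzag_expand_snoc set_rail)

lemma successively_split:
  "(\<And>us a b ws. xs = us @ a # b # ws \<Longrightarrow> P a b) \<Longrightarrow> successively P xs"
proof (induction P xs rule: successively.induct)
  case (3 P x y xs)
  have "P x y" using 3(2)[of "[]"] by simp
  moreover have "successively P (y # xs)"
    by (rule 3(1)) (use 3(2)[of "x # _"] in auto)
  ultimately show ?case by simp
qed simp_all

text \<open>Condition (z1) over \<open>L'\<close>; condition (z2) is treated in
  \<open>J_run_snoc_max\<close>.\<close>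

locale zigzag_ends =
  fixes L :: "perm set" and L' :: "perm set" and m :: nat
  assumes L_Sn: "L \<subseteq> Sn (Suc m)"
    and pdel_L: "pdel (Suc m) ` L = L'"
    and first_in: "x \<in> L' \<Longrightarrow> ins x (Suc 0) \<in> L"
    and last_in: "x \<in> L' \<Longrightarrow> ins x (Suc m) \<in> L"
begin

lemma L'_Sn: "L' \<subseteq> Sn m"
  using L_Sn pdel_L pdel_Sn by blast

text \<open>Agrees with \<open>ins\<close> on \<open>Sn m\<close>, but always adds
  \<open>Suc m\<close>, whatever the length of \<open>y\<close>; so \<open>add_max_in_iff\<close>
  holds for all lists.\<close>

definition add_max :: "bool \<Rightarrow> perm \<Rightarrow> perm" where
  "add_max b y = (if b then y @ [Suc m] else Suc m # y)"

lemma add_max_ins: "y \<in> Sn m \<Longrightarrow> add_max b y = ins y (if b then Suc m else Suc 0)"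
  using ins_1[of y] ins_Suc_length[of y] Sn_length[of y m] by (simp add: add_max_def)

lemma add_max_in_iff: "add_max b y \<in> L \<longleftrightarrow> y \<in> L'"
proof
  assume a: "add_max b y \<in> L"
  then have "add_max b y \<in> Sn (Suc m)" using L_Sn by blast
  then have "Suc m \<notin> set y" by (auto simp: Sn_def add_max_def split: if_splits)
  then have "pdel (Suc m) (add_max b y) = y" by (simp add: add_max_def pdel_def)
  then show "y \<in> L'" using a pdel_L by force
next
  assume "y \<in> L'"
  then show "add_max b y \<in> L" using add_max_ins[of y b] L'_Sn first_in last_in by auto
qed

lemma jump_add_max:
  assumes "x \<in> Sn m" "v \<in> {2..m}"
  shows "jump (add_max b x) v dir d = map_option (add_max b) (jump x v dir d)"
proof -
  have "v \<in> set x" "v < Suc m" using assms by (auto simp: Sn_def)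
  then show ?thesis using jump_snoc_max[of v x] jump_Cons_max[of v x]
    by (cases b) (simp_all add: add_max_def[abs_def])
qed

text \<open>The last rail has index \<open>length vs - 1\<close>, of opposite parity, so it ends on
  the side where the next rail begins.\<close>

lemma last_zigzag_expand:
  assumes "vs \<noteq> []" "set vs \<subseteq> L'"
  shows "last (zigzag_expand L m vs) = add_max (even (length vs)) (last vs)"
proof -
  obtain us y where vs: "vs = us @ [y]" using assms(1) by (metis rev_exhaust)
  then have y: "y \<in> L'" using assms(2) by simp
  then have "y \<in> Sn m" using L'_Sn by blast
  then show ?thesis using rail_ends[OF first_in[OF y] last_in[OF y]] vs
    by (simp add: zigzag_expand_snoc add_max_ins)
qed

lemma add_max_visited_iff:
  assumes "set vs \<subseteq> L'" "y \<in> L'"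
  shows "add_max b y \<in> set (zigzag_expand L m vs) \<longleftrightarrow> y \<in> set vs"
proof
  have y: "y \<in> Sn m" using assms L'_Sn by blast
  {
    assume "add_max b y \<in> set (zigzag_expand L m vs)"
    then obtain x i where "x \<in> set vs" "ins x i = ins y (if b then Suc m else Suc 0)"
      unfolding add_max_ins[OF y] set_zigzag_expand by auto
    moreover from this have "x \<in> Sn m" using assms L'_Sn by blast
    ultimately show "y \<in> set vs" using pdel_ins y by metis
  }
  assume "y \<in> set vs"
  then show "add_max b y \<in> set (zigzag_expand L m vs)"
    unfolding add_max_ins[OF y] set_zigzag_expand using first_in last_in assms by force
qed

text \<open>At the end of a completed rail the maximum has only visited targets. It stands at an
  end, so the smaller values jump as in the run for \<open>L'\<close>; the result
  \<open>None\<close> carries over as well.\<close>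

lemma J_next_zigzag_expand:
  assumes vs: "vs \<noteq> []" "set vs \<subseteq> L'"
  shows "J_next L (Suc m) (zigzag_expand L m vs) =
    map_option (add_max (even (length vs))) (J_next L' m vs)"
proof (rule J_next_less_max)
  let ?b = "even (length vs)" and ?E = "zigzag_expand L m vs"
  have lS: "last vs \<in> Sn m" and lin: "last vs \<in> set vs" using vs L'_Sn by (auto simp: subset_iff)
  have la: "last ?E = add_max ?b (last vs)" using vs by (rule last_zigzag_expand)
  have "jcand L ?E (Suc m) dir = None" for dir
    by (rule jcand_max_None[OF lS, where i = "if ?b then Suc m else Suc 0"])
      (use lin in \<open>auto simp: la add_max_ins[OF lS] set_zigzag_expand\<close>)
  then show "jcand L ?E (Suc m) JLeft = None" "jcand L ?E (Suc m) JRight = None" by blast+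
  fix v dir assume v: "v \<in> {2..m}"
  have mj: "min_jump L (last ?E) v dir = map_option (add_max ?b) (min_jump L' (last vs) v dir)"
    unfolding la by (rule min_jump_map) (simp_all add: jump_add_max[OF lS v] add_max_in_iff)
  show "jcand L ?E v dir = map_option (add_max ?b) (jcand L' vs v dir)"
  proof (cases "min_jump L' (last vs) v dir")
    case None
    then show ?thesis using mj by (simp add: jcand_def)
  next
    case (Some y)
    then have "y \<in> L'" using min_jumpD by blast
    then show ?thesis using Some mj add_max_visited_iff[OF vs(2), of y ?b] by (simp add: jcand_def)
  qed
qed

lemma J_path_zigzag_expand:
  assumes "1 \<le> m" "J_path L' m vs" "set vs \<subseteq> L'"
  shows "J_path L (Suc m) (zigzag_expand L m vs)"
  using assms(2,3)
proof (induction vs rule: rev_induct)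
  case Nil
  then show ?case by (simp add: J_path_def)
next
  case (snoc y vs)
  let ?E = "zigzag_expand L m vs" and ?b = "even (length vs)"
  have y: "y \<in> L'" "y \<in> Sn m" and vs: "set vs \<subseteq> L'" using snoc.prems L'_Sn by auto
  have yvs: "y \<notin> set vs" using J_path_distinct[OF snoc.prems(1)] by simp
  have E: "J_path L (Suc m) ?E" using snoc J_path_prefix by auto
  \<comment> \<open>Earlier rails lie over permutations other than \<open>y\<close>, as paths do not
    repeat.\<close>
  have pre: "ins y k \<notin> set ?E" for k
  proof
    assume "ins y k \<in> set ?E"
    then obtain x i where "x \<in> set vs" "ins y k = ins x i" by (auto simp: set_zigzag_expand)
    then show False using pdel_ins[of x m i] pdel_ins[OF y(2), of k] vs L'_Sn yvs by auto
  qed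
  show ?case
    unfolding zigzag_expand_snoc
  proof (rule J_path_appendI[OF E])
    fix as z bs assume r: "rail L m y ?b = as @ z # bs" and ne: "?E @ as \<noteq> []"
    show "J_next L (Suc m) (?E @ as) = Some z"
    proof (cases "as = []")
      \<comment> \<open>The first element of the new rail comes from the step of the algorithm on
        \<open>L'\<close>; the later ones are jumps of the maximum.\<close>
      case True
      then have "vs \<noteq> []" using ne by auto
      then have "J_next L' m vs = Some y" using snoc.prems(1) unfolding J_path_def by blast
      moreover have "z = add_max ?b y"
        using rail_ends(2)[OF first_in[OF y(1)] last_in[OF y(1)], of ?b] r True
        by (simp add: add_max_ins[OF y(2)])
      ultimately show ?thesis using J_next_zigzag_expand[OF \<open>vs \<noteq> []\<close> vs] True by simp
    next
      case False
      show ?thesis using J_next_rail[OF y(2) assms(1) r False] pre by blast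
    qed
  qed
qed

text \<open>Consecutive rails are joined at a common end, first or last according to parity, so
  \<open>P\<close> is asked at both.\<close>

lemma successively_zigzag_expand:
  assumes "set vs \<subseteq> L'"
    and "\<And>x b. x \<in> set vs \<Longrightarrow> successively P (rail L m x b)"
    and "successively (\<lambda>x y. P (ins x (Suc 0)) (ins y (Suc 0)) \<and> P (ins x (Suc m)) (ins y (Suc m))) vs"
  shows "successively P (zigzag_expand L m vs)"
  using assms
proof (induction vs rule: rev_induct)
  case (snoc y vs)
  let ?E = "zigzag_expand L m vs" and ?b = "even (length vs)"
  have y: "y \<in> L'" "y \<in> Sn m" and vs: "set vs \<subseteq> L'" using snoc.prems L'_Sn by auto
  have E: "successively P ?E" using snoc by (simp add: successively_append_iff)
  have "P (last ?E) (hd (rail L m y ?b))" if "vs \<noteq> []"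
  proof -
    have "last vs \<in> Sn m" using that vs L'_Sn last_in_set[of vs] by blast
    moreover have "P (ins (last vs) (Suc 0)) (ins y (Suc 0))" "P (ins (last vs) (Suc m)) (ins y (Suc m))"
      using snoc.prems(3) that by (simp_all add: successively_append_iff)
    ultimately show ?thesis
      using last_zigzag_expand[OF that vs] rail_ends(2)[OF first_in[OF y(1)] last_in[OF y(1)], of ?b]
      by (simp add: add_max_ins)
  qed
  then show ?case using E snoc.prems(2)
    using zigzag_expand_snoc[of L m "[]" y]
    by (cases "vs = []") (simp_all add: zigzag_expand_snoc successively_append_iff)
qed simp

lemma J_run_zigzag_expand:
  assumes m: "1 \<le> m" and run: "J_run L' m x0 ps" and L': "set ps = L'"
  shows "J_run L (Suc m) (ins x0 (Suc m)) (zigzag_expand L m ps)"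
    and "set (zigzag_expand L m ps) = L"
proof -
  have ps: "ps \<noteq> []" "hd ps = x0" "J_path L' m ps" "J_next L' m ps = None" and sub: "set ps \<subseteq> L'"
    using run L' by (auto simp: J_run_iff_J_path)
  have "zigzag_expand L m ps \<noteq> [] \<and> hd (zigzag_expand L m ps) = ins (hd ps) (Suc m)"
    using ps(1) sub
  proof (induction ps rule: rev_nonempty_induct)
    case (single x)
    then have "rail L m x True \<noteq> []" "hd (rail L m x True) = ins x (Suc m)"
      using rail_ends first_in last_in by auto
    then show ?case using zigzag_expand_snoc[of L m "[]" x] by simp
  next
    case (snoc x xs)
    then show ?case by (simp add: zigzag_expand_snoc)
  qed
  then show "J_run L (Suc m) (ins x0 (Suc m)) (zigzag_expand L m ps)"
    using J_path_zigzag_expand[OF m ps(3) sub] J_next_zigzag_expand[OF ps(1) sub] ps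
    by (simp add: J_run_iff_J_path)
  have "\<exists>x i. z = ins x i \<and> x \<in> L' \<and> i \<in> {1..Suc m}" if "z \<in> L" for z
    using ins_pdel[of z m] that L_Sn pdel_L by blast
  then show "set (zigzag_expand L m ps) = L"
    unfolding set_zigzag_expand L' by blast
qed

end

text \<open>The case (z2): each rail is reduced to its last element, so the maximum never moves and
  the smaller values run as before.\<close>

lemma J_run_snoc_max:
  assumes L': "L' \<subseteq> Sn m" and run: "J_run L' m x0 ps" and ps: "set ps = L'"
  shows "J_run ((\<lambda>x. ins x (Suc m)) ` L') (Suc m) (ins x0 (Suc m)) (map (\<lambda>x. ins x (Suc m)) ps)"
proof -
  \<comment> \<open>The two maps agree on \<open>Sn m\<close>; \<open>?f\<close> gives the
    membership equivalence \<open>f_in\<close> for arbitrary lists, \<open>?c\<close> is the form in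
    the statement.\<close>
  let ?f = "\<lambda>x. x @ [Suc m]" and ?c = "\<lambda>x. ins x (Suc m)"
  let ?L = "?c ` L'"
  have c: "?c x = ?f x" if "x \<in> Sn m" for x
    using that ins_Suc_length[of x] Sn_length[OF that] by simp
  have f_in: "?f y \<in> ?L \<longleftrightarrow> y \<in> L'" for y
    using c L' by (auto simp: image_iff subset_iff)
  have next_map: "J_next ?L (Suc m) (map ?c vs) = map_option ?c (J_next L' m vs)"
    if vs: "vs \<noteq> []" "set vs \<subseteq> L'" for vs
  proof -
    have l: "last vs \<in> Sn m" using vs L' last_in_set[of vs] by blast
    have map: "map ?c vs = map ?f vs" using vs(2) L' c by (auto simp: subset_iff)
    have la: "last (map ?c vs) = ?c (last vs)" "last (map ?c vs) = ?f (last vs)"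
      using vs(1) map by (simp_all add: last_map)
    have "J_next ?L (Suc m) (map ?c vs) = map_option ?f (J_next L' m vs)"
    proof (rule J_next_less_max)
      have "ins (last vs) k \<in> set (map ?c vs)" if "k \<in> {1..Suc m}" "ins (last vs) k \<in> ?L" for k
      proof -
        obtain y where y: "y \<in> L'" "ins (last vs) k = ?c y" using \<open>ins (last vs) k \<in> ?L\<close> by blast
        then have "y = last vs" using pdel_ins[OF l, of k] pdel_ins[of y m "Suc m"] L' by auto
        then show ?thesis using y vs(1) by simp
      qed
      then have "jcand ?L (map ?c vs) (Suc m) dir = None" for dir
        by (intro jcand_max_None[OF l _ la(1)]) auto
      then show "jcand ?L (map ?c vs) (Suc m) JLeft = None" "jcand ?L (map ?c vs) (Suc m) JRight = None"
        by blast+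
      fix v dir assume v: "v \<in> {2..m}"
      then have v': "v \<in> set (last vs)" "v < Suc m" using l by (auto simp: Sn_def)
      have "min_jump ?L (?f (last vs)) v dir = map_option ?f (min_jump L' (last vs) v dir)"
        by (rule min_jump_map) (simp_all only: jump_snoc_max[OF v'] f_in)
      then have mj: "min_jump ?L (last (map ?c vs)) v dir = map_option ?f (min_jump L' (last vs) v dir)"
        unfolding la(2) .
      have "?f y \<in> set (map ?c vs) \<longleftrightarrow> y \<in> set vs" for y
        unfolding map by auto
      then show "jcand ?L (map ?c vs) v dir = map_option ?f (jcand L' vs v dir)"
        unfolding jcand_def mj by (cases "min_jump L' (last vs) v dir") simp_all
    qed
    also have "\<dots> = map_option ?c (J_next L' m vs)"
      using c L' J_nextD[of L' m vs] by (intro option.map_cong) (auto simp: subset_iff)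
    finally show ?thesis .
  qed
  have pth: "J_path L' m ps" using run by (simp add: J_run_iff_J_path)
  have "J_path ?L (Suc m) (map ?c ps)"
    unfolding J_path_def
  proof (intro allI impI)
    fix us y ws assume "map ?c ps = us @ y # ws" "us \<noteq> []"
    then obtain us' y' ws' where s: "ps = us' @ y' # ws'" "us = map ?c us'" "y = ?c y'" "us' \<noteq> []"
      by (auto simp: map_eq_append_conv map_eq_Cons_conv)
    then have "J_next L' m us' = Some y'" using pth unfolding J_path_def by blast
    then show "J_next ?L (Suc m) us = Some y" using next_map[of us'] s ps by auto
  qed
  then show ?thesis using run next_map[of ps] ps by (auto simp: J_run_iff_J_path hd_map)
qed

subsection \<open>The sets of representatives\<close>

lemma is_R_Sn: "is_R n eq R \<Longrightarrow> R \<subseteq> Sn n"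
proof (induction n arbitrary: eq R)
  case 0
  then show ?case by (simp add: Sn_def)
next
  case (Suc m)
  then obtain R' where R': "R' \<subseteq> Sn m" and R: "R \<subseteq> (\<Union>x\<in>R'. ins x ` {1..Suc m})"
    by (fastforce split: if_splits)
  then show ?case using ins_Sn by blast
qed

lemma is_R_exists:
  assumes "lattice_congruence n eq"
  shows "\<exists>R. is_R n eq R"
  using assms
proof (induction n arbitrary: eq)
  case 0
  then show ?case by simp
next
  case (Suc m)
  note c = Suc.prems
  obtain R' where R': "is_R m (restr m eq) R'" using Suc.IH restr_congruence[OF c] by blast
  show ?case
  proof (cases "eq (id_perm (Suc m)) (ins (id_perm m) m)")
    case True
    then show ?thesis using R' by auto
  next
    case False
    have "\<forall>x\<in>R'. \<exists>P. P \<subseteq> ins x ` {1..Suc m} \<and> ins x 1 \<in> P \<and> ins x (Suc m) \<in> P \<and>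
        (\<forall>z\<in>ins x ` {1..Suc m}. \<exists>!y. y \<in> P \<and> eq z y)"
    proof
      fix x assume that: "x \<in> R'"
      have x: "x \<in> Sn m" using that is_R_Sn[OF R'] by blast
      let ?A = "ins x ` {1..Suc m}"
      have A: "a \<in> Sn (Suc m)" if "a \<in> ?A" for a using that ins_Sn[OF x] by blast
      have ends: "ins x 1 \<in> ?A" "ins x (Suc m) \<in> ?A" by auto
      have ne: "\<not> eq (ins x (Suc m)) (ins x 1)" using rail_ends_inequiv[OF c x False] by simp
      \<comment> \<open>\<open>g\<close> selects one element per class on the rail and prefers the
        two ends, so both are selected. This is consistent because the ends are
        inequivalent.\<close>
      define g where "g z = (if eq z (ins x 1) then ins x 1
        else if eq z (ins x (Suc m)) then ins x (Suc m) else SOME y. y \<in> ?A \<and> eq z y)" for z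
      have g: "g z \<in> ?A \<and> eq z (g z)" if z: "z \<in> ?A" for z
        using ends z cong_refl[OF c A[OF z]] someI[of "\<lambda>y. y \<in> ?A \<and> eq z y" z]
        unfolding g_def by presburger
      \<comment> \<open>Equivalent arguments leave the same predicate under \<open>SOME\<close>,
        hence the same choice.\<close>
      have g_cong: "g z = g z'" if "z \<in> ?A" "z' \<in> ?A" "eq z z'" for z z'
      proof -
        have "eq z y \<longleftrightarrow> eq z' y" if "y \<in> ?A" for y
          using cong_trans[OF c A A A] cong_sym[OF c A A] that \<open>z \<in> ?A\<close> \<open>z' \<in> ?A\<close> \<open>eq z z'\<close>
          by blast
        moreover from this have "(\<lambda>y. y \<in> ?A \<and> eq z y) = (\<lambda>y. y \<in> ?A \<and> eq z' y)" by blast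
        ultimately show ?thesis unfolding g_def using ends by simp
      qed
      have g1: "g (ins x 1) = ins x 1"
        unfolding g_def using cong_refl[OF c A[OF ends(1)]] by simp
      have gm: "g (ins x (Suc m)) = ins x (Suc m)"
        unfolding g_def using ne cong_refl[OF c A[OF ends(2)]] by simp
      have "\<exists>!y. y \<in> g ` ?A \<and> eq z y" if z: "z \<in> ?A" for z
      proof (rule ex1I[of _ "g z"])
        show "g z \<in> g ` ?A \<and> eq z (g z)" using g z by blast
        fix y assume "y \<in> g ` ?A \<and> eq z y"
        then obtain z' where z': "z' \<in> ?A" "y = g z'" "eq z (g z')" by blast
        then have "eq z z'"
          using cong_trans[OF c A A A] cong_sym[OF c A A] g z by meson
        then show "y = g z" using g_cong z z' by metis
      qed
      moreover have "ins x 1 \<in> g ` ?A" "ins x (Suc m) \<in> g ` ?A"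
        using g1 gm ends by (metis imageI)+
      moreover have "g ` ?A \<subseteq> ?A" using g by blast
      ultimately show "\<exists>P. P \<subseteq> ins x ` {1..Suc m} \<and> ins x 1 \<in> P \<and> ins x (Suc m) \<in> P \<and>
        (\<forall>z\<in>ins x ` {1..Suc m}. \<exists>!y. y \<in> P \<and> eq z y)"
        by (intro exI[of _ "g ` ?A"] conjI ballI)
    qed
    from bchoice[OF this] obtain Rp where "\<forall>x\<in>R'. Rp x \<subseteq> ins x ` {1..Suc m} \<and> ins x 1 \<in> Rp x \<and>
        ins x (Suc m) \<in> Rp x \<and> (\<forall>z\<in>ins x ` {1..Suc m}. \<exists>!y. y \<in> Rp x \<and> eq z y)"
      ..
    then have "is_R (Suc m) eq (\<Union>x\<in>R'. Rp x)"
      unfolding is_R.simps using R' False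
      by (intro exI[of _ R'] conjI) (simp_all only: not_False_eq_True if_True, blast)
    then show ?thesis ..
  qed
qed

text \<open>Existence: the class of \<open>z\<close> meets the rail over the representative of
  \<open>pdel (Suc m) z\<close>. Uniqueness: deletions of equivalent elements are equivalent under
  the restriction, so two representatives would lie on the same rail. The last two premises isolate
  what differs between the cases of the recursion.\<close>

lemma reps_lift:
  assumes c: "lattice_congruence (Suc m) eq" and R: "R \<subseteq> Sn (Suc m)"
    and pd: "pdel (Suc m) ` R \<subseteq> R'" and R': "R' \<subseteq> Sn m"
    and reps': "\<forall>z\<in>Sn m. \<exists>!y. y \<in> R' \<and> restr m eq z y"
    and rail: "\<And>x k. x \<in> R' \<Longrightarrow> k \<in> {1..Suc m} \<Longrightarrow> \<exists>y\<in>R. eq (ins x k) y"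
    and rail_unique: "\<And>y y'. y \<in> R \<Longrightarrow> y' \<in> R \<Longrightarrow> pdel (Suc m) y = pdel (Suc m) y' \<Longrightarrow> eq y y' \<Longrightarrow> y = y'"
  shows "\<forall>z\<in>Sn (Suc m). \<exists>!y. y \<in> R \<and> eq z y"
proof
  fix z assume z: "z \<in> Sn (Suc m)"
  obtain q where q: "q \<in> R'" "restr m eq (pdel (Suc m) z) q" using reps' pdel_Sn[OF z] by blast
  then have qS: "q \<in> Sn m" using R' by blast
  obtain k where k: "k \<in> {1..Suc m}" "eq z (ins q k)"
    using class_meets_rail[OF c z qS q(2)] by blast
  then obtain y where y: "y \<in> R" "eq (ins q k) y" using rail q by blast
  show "\<exists>!y. y \<in> R \<and> eq z y"
  proof (rule ex1I[of _ y])
    show y': "y \<in> R \<and> eq z y"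
      using y k cong_trans[OF c z ins_Sn[OF qS]] R by blast
    fix w assume w: "w \<in> R \<and> eq z w"
    have yS: "y \<in> Sn (Suc m)" "w \<in> Sn (Suc m)" using y w R by auto
    have e: "eq w y" using cong_trans[OF c yS(2) z yS(1)] cong_sym[OF c z yS(2)] w y' by blast
    have "restr m eq (pdel (Suc m) w) (pdel (Suc m) y)"
      using restr_pdel[OF c yS(2) yS(1) e] .
    moreover have "pdel (Suc m) w \<in> R'" "pdel (Suc m) y \<in> R'" using pd y w by auto
    moreover have "restr m eq (pdel (Suc m) w) (pdel (Suc m) w)"
      using cong_refl[OF restr_congruence[OF c] pdel_Sn[OF yS(2)]] .
    ultimately have "pdel (Suc m) w = pdel (Suc m) y" using reps' pdel_Sn[OF yS(2)] by blast
    then show "w = y" using rail_unique w y e by blast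
  qed
qed

text \<open>All claims go through one induction on the restriction. Adjacency is carried as
  \<open>class_adj\<close>, the form that lifts to rail ends.\<close>

lemma is_R_properties:
  assumes "lattice_congruence n eq" "is_R n eq R"
  shows "(\<forall>z\<in>Sn n. \<exists>!y. y \<in> R \<and> eq z y) \<and> zigzag n R \<and>
    (\<exists>ps. J_run R n (id_perm n) ps \<and> set ps = R \<and> successively (class_adj n eq) ps)"
  using assms
proof (induction n arbitrary: eq R)
  case 0
  have "J_run {[]} 0 (id_perm 0) [[]]"
    by (auto simp: J_run_def J_next_def id_perm_def)
  moreover have "eq [] []" using cong_refl[OF 0(1)] by (simp add: Sn_def)
  ultimately show ?case using 0(2)
    by (auto simp: Sn_def intro!: exI[of _ "[[]]"])
next
  case (Suc m)
  note c = Suc.prems(1)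
  have cm: "lattice_congruence m (restr m eq)" using c by (rule restr_congruence)
  obtain R' where R': "is_R m (restr m eq) R'"
    and split: "if \<not> eq (id_perm (Suc m)) (ins (id_perm m) m)
       then (\<exists>Rp. (\<forall>x\<in>R'. Rp x \<subseteq> ins x ` {1..Suc m} \<and>
                             ins x 1 \<in> Rp x \<and> ins x (Suc m) \<in> Rp x \<and>
                             (\<forall>z\<in>ins x ` {1..Suc m}. \<exists>!y. y \<in> Rp x \<and> eq z y)) \<and>
                  R = (\<Union>x\<in>R'. Rp x))
       else R = (\<lambda>x. ins x (Suc m)) ` R'"
    using Suc.prems(2) unfolding is_R.simps by blast
  have R'S: "R' \<subseteq> Sn m" using R' by (rule is_R_Sn)
  have RS: "R \<subseteq> Sn (Suc m)" using Suc.prems(2) by (rule is_R_Sn)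
  obtain ps where reps': "\<forall>z\<in>Sn m. \<exists>!y. y \<in> R' \<and> restr m eq z y" and zz: "zigzag m R'"
    and run: "J_run R' m (id_perm m) ps" and ps: "set ps = R'"
    and adj: "successively (class_adj m (restr m eq)) ps"
    using Suc.IH[OF cm R'] by blast
  have lift: "class_adj (Suc m) eq (ins x e) (ins y e)"
    if "class_adj m (restr m eq) x y" "x \<in> R'" "y \<in> R'" "e \<in> {Suc 0, Suc m}" for x y e
    using class_adj_lift[OF c _ _ that(1) that(4)] that R'S by blast
  show ?case
  proof (cases "eq (id_perm (Suc m)) (ins (id_perm m) m)")
    case True
    then have R: "R = (\<lambda>x. ins x (Suc m)) ` R'" using split by simp
    have pdc: "pdel (Suc m) (ins x (Suc m)) = x" if "x \<in> R'" for x
      using that R'S by (intro pdel_ins) blast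
    have pR: "pdel (Suc m) ` R = R'" unfolding R image_image using pdc by simp
    have "\<forall>z\<in>Sn (Suc m). \<exists>!y. y \<in> R \<and> eq z y"
    proof (rule reps_lift[OF c RS _ R'S reps'])
      show "pdel (Suc m) ` R \<subseteq> R'" using pR by blast
    next
      fix x k assume "x \<in> R'" "k \<in> {1..Suc m}"
      then have "eq (ins x k) (ins x (Suc m))"
        using rail_equiv[OF c _ True] cong_sym[OF c ins_Sn ins_Sn] R'S by blast
      then show "\<exists>y\<in>R. eq (ins x k) y" using \<open>x \<in> R'\<close> R by blast
    next
      fix y y' assume "y \<in> R" "y' \<in> R" "pdel (Suc m) y = pdel (Suc m) y'"
      then show "y = y'" unfolding R using pdc by auto
    qed
    moreover have "zigzag (Suc m) R" using RS zz pR R by simp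
    moreover have "J_run R (Suc m) (id_perm (Suc m)) (map (\<lambda>x. ins x (Suc m)) ps)"
      using J_run_snoc_max[OF R'S run ps] unfolding R id_perm_Suc[symmetric] .
    moreover have "successively (class_adj (Suc m) eq) (map (\<lambda>x. ins x (Suc m)) ps)"
      unfolding successively_map
      by (rule successively_mono[OF adj]) (use lift ps in auto)
    moreover have "set (map (\<lambda>x. ins x (Suc m)) ps) = R" using ps R by simp
    ultimately show ?thesis by blast
  next
    case False
    have "\<exists>Rp. (\<forall>x\<in>R'. Rp x \<subseteq> ins x ` {1..Suc m} \<and> ins x 1 \<in> Rp x \<and> ins x (Suc m) \<in> Rp x \<and>
        (\<forall>z\<in>ins x ` {1..Suc m}. \<exists>!y. y \<in> Rp x \<and> eq z y)) \<and> R = (\<Union>x\<in>R'. Rp x)"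
      using split unfolding if_P[OF False] .
    then obtain Rp where all: "\<forall>x\<in>R'. Rp x \<subseteq> ins x ` {1..Suc m} \<and>
        ins x 1 \<in> Rp x \<and> ins x (Suc m) \<in> Rp x \<and> (\<forall>z\<in>ins x ` {1..Suc m}. \<exists>!y. y \<in> Rp x \<and> eq z y)"
      and R: "R = (\<Union>x\<in>R'. Rp x)"
      by (elim exE conjE) (rule that)
    note Rp = all[THEN bspec, THEN conjunct1] all[THEN bspec, THEN conjunct2, THEN conjunct1]
      all[THEN bspec, THEN conjunct2, THEN conjunct2, THEN conjunct1]
      all[THEN bspec, THEN conjunct2, THEN conjunct2, THEN conjunct2, THEN bspec]
    \<comment> \<open>For \<open>m = 0\<close>, inserting at position \<open>0\<close> acts like
      position \<open>1\<close> and gives the identity, which is equivalent to itself.\<close>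
    have m: "1 \<le> m"
    proof (rule ccontr)
      assume "\<not> 1 \<le> m"
      then have "ins (id_perm m) m = id_perm (Suc m)" by (simp add: id_perm_def ins_def)
      then show False using False cong_refl[OF c id_perm_Sn] by metis
    qed
    have pd: "pdel (Suc m) y = x" if "y \<in> Rp x" "x \<in> R'" for x y
      using Rp(1)[OF that(2)] that pdel_ins[of x m] R'S by blast
    have R_rail: "y \<in> Rp (pdel (Suc m) y)" if "y \<in> R" for y
      using that pd unfolding R by blast
    interpret zigzag_ends R R' m
    proof
      show "R \<subseteq> Sn (Suc m)" by (rule RS)
      show "pdel (Suc m) ` R = R'"
      proof
        show "pdel (Suc m) ` R \<subseteq> R'" using pd unfolding R by auto
        show "R' \<subseteq> pdel (Suc m) ` R"
        proof
          fix x assume "x \<in> R'"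
          then have "ins x 1 \<in> R" "pdel (Suc m) (ins x 1) = x" using Rp(2) pd R by blast+
          then show "x \<in> pdel (Suc m) ` R" by (metis imageI)
        qed
      qed
      show "ins x (Suc 0) \<in> R" "ins x (Suc m) \<in> R" if "x \<in> R'" for x
        using Rp(2,3) that unfolding R by auto
    qed
    have reps: "\<forall>z\<in>Sn (Suc m). \<exists>!y. y \<in> R \<and> eq z y"
    proof (rule reps_lift[OF c RS _ R'S reps'])
      show "pdel (Suc m) ` R \<subseteq> R'" using pdel_L by blast
    next
      fix x k assume "x \<in> R'" "k \<in> {1..Suc m}"
      then show "\<exists>y\<in>R. eq (ins x k) y" using Rp(4)[of x "ins x k"] R by blast
    next
      fix y y' assume y: "y \<in> R" "y' \<in> R" "pdel (Suc m) y = pdel (Suc m) y'" "eq y y'"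
      have x: "pdel (Suc m) y \<in> R'" using y(1) pdel_L by blast
      have "y \<in> Rp (pdel (Suc m) y)" "y' \<in> Rp (pdel (Suc m) y)"
        using R_rail[OF y(1)] R_rail[OF y(2)] y(3) by simp_all
      moreover from this have "y \<in> ins (pdel (Suc m) y) ` {1..Suc m}" using Rp(1)[OF x] by blast
      moreover have "eq y y" using cong_refl[OF c] y(1) RS by blast
      ultimately show "y = y'" using Rp(4)[OF x] y(4) by blast
    qed
    have rails: "successively (class_adj (Suc m) eq) (rail R m x b)" if x: "x \<in> R'" for x b
    proof (rule successively_split)
      fix us y z ws assume "rail R m x b = us @ y # z # ws"
      then obtain i j where ij: "y = ins x i" "z = ins x j" "i \<in> {1..Suc m}" "j \<in> {1..Suc m}"
        "y \<in> R" "z \<in> R" "if b then j < i else i < j"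
        and btw: "\<And>k. k \<in> {1..Suc m} \<Longrightarrow> ins x k \<in> R \<Longrightarrow> (if b then k < i else i < k) \<Longrightarrow>
          (if b then k \<le> j else j \<le> k)"
        by (rule rail_consecutive) blast
      have xS: "x \<in> Sn m" using x R'S by blast
      have "y \<noteq> z" using ins_inj[OF xS ij(3,4)] ij(1,2,7) by (auto split: if_splits)
      have "eq y y" "eq z z" using ij(5,6) RS cong_refl[OF c] by blast+
      then have ne: "\<not> eq y z" "\<not> eq z y" using reps \<open>y \<noteq> z\<close> ij(5,6) RS by blast+
      \<comment> \<open>The representative of a class on the rail lies in \<open>R\<close>, so its
        position is not strictly between the consecutive positions \<open>i\<close> and
        \<open>j\<close>.\<close>
      have rr: "\<exists>l\<in>{1..Suc m}. l \<notin> (if b then {j<..<i} else {i<..<j}) \<and> eq (ins x k) (ins x l)"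
        if k: "k \<in> {1..Suc m}" for k
      proof -
        obtain w where w: "w \<in> Rp x" "eq (ins x k) w" using Rp(4)[OF x] k by blast
        then obtain l where l: "l \<in> {1..Suc m}" "w = ins x l" using Rp(1)[OF x] by blast
        have "ins x l \<in> R" using w l x R by blast
        then have "l \<notin> (if b then {j<..<i} else {i<..<j})" using btw[OF l(1)] by (auto split: if_splits)
        then show ?thesis using l w by blast
      qed
      show "class_adj (Suc m) eq y z"
      proof (cases b)
        case True
        then show ?thesis
          using class_adj_rail[OF c xS, of j i] ij(1-4,7) ne rr by simp
      next
        \<comment> \<open>On a rightward rail \<open>z\<close> has the smaller position, so the
          roles of \<open>y\<close> and \<open>z\<close> are exchanged.\<close>
        case False
        then have "class_adj (Suc m) eq z y"
          using class_adj_rail[OF c xS, of i j] ij(1-4,7) ne rr by simp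
        then show ?thesis by (rule class_adj_sym)
      qed
    qed
    let ?E = "zigzag_expand R m ps"
    have "successively (class_adj (Suc m) eq) ?E"
    proof (rule successively_zigzag_expand)
      show "set ps \<subseteq> R'" using ps by simp
      show "successively (class_adj (Suc m) eq) (rail R m x b)" if "x \<in> set ps" for x b
        using rails that ps by blast
      show "successively (\<lambda>x y. class_adj (Suc m) eq (ins x (Suc 0)) (ins y (Suc 0)) \<and>
          class_adj (Suc m) eq (ins x (Suc m)) (ins y (Suc m))) ps"
        by (rule successively_mono[OF adj]) (use lift ps in auto)
    qed
    moreover have "zigzag (Suc m) R" using RS zz pdel_L first_in last_in by simp
    ultimately show ?thesis
      using reps J_run_zigzag_expand[OF m run ps] unfolding id_perm_Suc[symmetric] by blast
  qed
qed

theorem mainTheorem1: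
  fixes n :: nat and eq :: "perm \<Rightarrow> perm \<Rightarrow> bool"
  assumes "n \<ge> 1" and "lattice_congruence n eq"
  shows "(\<exists>R. is_R n eq R) \<and>
    (\<forall>R. is_R n eq R \<longrightarrow>
       (\<forall>X\<in>classes n eq. \<exists>!x. x \<in> R \<and> x \<in> X) \<and>
       zigzag n R \<and>
       (\<exists>ps. J_run R n (id_perm n) ps \<and> distinct ps \<and> set ps = R \<and>
             distinct (map (cls n eq) ps) \<and> set (map (cls n eq) ps) = classes n eq \<and>
             (\<forall>i. Suc i < length ps \<longrightarrow> qadj n eq (cls n eq (ps ! i)) (cls n eq (ps ! Suc i))))) \<and>
    (\<exists>Xs. distinct Xs \<and> set Xs = classes n eq \<and>
          (\<forall>i. Suc i < length Xs \<longrightarrow> qadj n eq (Xs ! i) (Xs ! Suc i)))"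
proof -
  note c = assms(2)
  have all: "(\<forall>X\<in>classes n eq. \<exists>!x. x \<in> R \<and> x \<in> X) \<and> zigzag n R \<and>
       (\<exists>ps. J_run R n (id_perm n) ps \<and> distinct ps \<and> set ps = R \<and>
             distinct (map (cls n eq) ps) \<and> set (map (cls n eq) ps) = classes n eq \<and>
             (\<forall>i. Suc i < length ps \<longrightarrow> qadj n eq (cls n eq (ps ! i)) (cls n eq (ps ! Suc i))))"
    if R: "is_R n eq R" for R
  proof -
    have RS: "R \<subseteq> Sn n" using R by (rule is_R_Sn)
    obtain ps where reps: "\<forall>z\<in>Sn n. \<exists>!y. y \<in> R \<and> eq z y" and zz: "zigzag n R"
      and run: "J_run R n (id_perm n) ps" and ps: "set ps = R"
      and adj: "successively (class_adj n eq) ps"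
      using is_R_properties[OF c R] by blast
    have d: "distinct ps" using run J_path_distinct by (auto simp: J_run_iff_J_path)
    have ne: "\<not> eq x y" if "x \<in> R" "y \<in> R" "x \<noteq> y" for x y
      using reps cong_refl[OF c] that RS by blast
    have "inj_on (cls n eq) R"
    proof (rule inj_onI)
      fix x y assume xy: "x \<in> R" "y \<in> R" and e: "cls n eq x = cls n eq y"
      have "y \<in> cls n eq y" using xy RS cong_refl[OF c] by (auto simp: cls_def)
      then have "eq x y" using e by (auto simp: cls_def)
      then show "x = y" using ne xy by blast
    qed
    then have dm: "distinct (map (cls n eq) ps)" using d ps by (simp add: distinct_map)
    have "cls n eq ` R = classes n eq"
    proof
      show "cls n eq ` R \<subseteq> classes n eq" using RS by (auto simp: classes_def)
      show "classes n eq \<subseteq> cls n eq ` R"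
      proof
        fix X assume "X \<in> classes n eq"
        then obtain z where z: "z \<in> Sn n" "X = cls n eq z" by (auto simp: classes_def)
        then obtain y where "y \<in> R" "eq z y" using reps by blast
        then show "X \<in> cls n eq ` R" using cls_eqI[OF c z(1)] z RS by blast
      qed
    qed
    then have sm: "set (map (cls n eq) ps) = classes n eq" using ps by simp
    \<comment> \<open>Distinct representatives are inequivalent; this is what turns
      \<open>class_adj\<close> into a cover.\<close>
    have qa: "qadj n eq (cls n eq (ps ! i)) (cls n eq (ps ! Suc i))" if i: "Suc i < length ps" for i
    proof -
      have "ps ! i \<in> R" "ps ! Suc i \<in> R" using i ps by auto
      moreover have "ps ! i \<noteq> ps ! Suc i" using i d by (simp add: nth_eq_iff_index_eq)
      moreover have "class_adj n eq (ps ! i) (ps ! Suc i)"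
        using adj i by (simp add: successively_conv_nth)
      ultimately show ?thesis using qadj_of_class_adj[OF c] ne RS by blast
    qed
    have "\<exists>!x. x \<in> R \<and> x \<in> X" if X: "X \<in> classes n eq" for X
    proof -
      obtain z where z: "z \<in> Sn n" "X = cls n eq z" using X by (auto simp: classes_def)
      then have "x \<in> R \<and> x \<in> X \<longleftrightarrow> x \<in> R \<and> eq z x" for x using RS by (auto simp: cls_def)
      then show ?thesis using reps z by simp
    qed
    then show ?thesis using zz run d ps dm sm qa by blast
  qed
  \<comment> \<open>The Hamilton path as such requires that some choice of \<open>R\<close>
    exists.\<close>
  obtain R where R: "is_R n eq R" using is_R_exists[OF c] by blast
  then obtain ps where ps: "distinct (map (cls n eq) ps)" "set (map (cls n eq) ps) = classes n eq"
    "\<forall>i. Suc i < length ps \<longrightarrow> qadj n eq (cls n eq (ps ! i)) (cls n eq (ps ! Suc i))"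
    using all by blast
  then have "\<exists>Xs. distinct Xs \<and> set Xs = classes n eq \<and>
      (\<forall>i. Suc i < length Xs \<longrightarrow> qadj n eq (Xs ! i) (Xs ! Suc i))"
    by (intro exI[of _ "map (cls n eq) ps"]) auto
  then show ?thesis using all R by blast
qed

end
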